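(* Consider unsplittable, splittable, or unit-demand $k$-MCVRP, where every customer satisfies $d(v)\le k$. Let $V'=\{v\in V: d(v)\le\lfloor k/2\rfloor\}$ and let $T'^*$ be a minimum-cost spanning tree of $H[V'\cup\{o\}]$ with respect to $c$. There is a polynomial-time algorithm that outputs a feasible solution of cost at most $\frac{2}{\lfloor k/2\rfloor+1}\Delta+2c(T'^* )$.
   Context: $k$-MCVRP: an instance consists of a complete undirected graph $G=(V\cup D,E)$ with customers $V$ and depots $D$ ($|D|=m$), a symmetric edge weight $w\ge 0$ satisfying the triangle inequality, demands $d(v)\in\mathbb{Z}_{\ge1}$, and a capacity $k\in\mathbb{Z}_{\ge1}$. A tour is a closed walk starting and ending at the same depot, passing through no other depot, delivering at most $k$ units in total to customers on it. A feasible solution is a collection of tours whose deliveries meet all demands; its cost is the total weight of traversed edges (with multiplicity). Splittable: demand may be split among tours; unsplittable: each customer's demand is delivered by one tour; unit-demand: all $d(v)=1$. Auxiliary graph: $H=(V\cup\{o\},F)$ is the complete graph obtained by replacing all depots by a single new depot $o$, with weights $c(o,v)=\min_{u\in D}w(u,v)$ and $c(v,v')=\min\{c(o,v)+c(o,v'),w(v,v')\}$ for $v,v'\in V$. $\Delta\coloneqq\sum_{v\in V}d(v)\,c(o,v)$. For a subset $S$ of vertices, $H[S]$ is the induced subgraph, and $c$ of a set of edges is their total weight. *)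

theory Defs
  imports
    Complex_Main
    "HOL-Library.Discrete_Functions"
    "HOL-Computational_Algebra.Polynomial"
begin

section \<open>Multidepot capacitated vehicle routing\<close>

record 'v mcvrp =
  customers :: "'v set"
  depots :: "'v set"
  weight :: "'v \<Rightarrow> 'v \<Rightarrow> real"
  demand :: "'v \<Rightarrow> nat"
  capacity :: nat

datatype problem_variant = Unsplittable | Splittable | Unit_Demand

abbreviation vertices :: "('v, 'b) mcvrp_scheme \<Rightarrow> 'v set" where
  "vertices I \<equiv> customers I \<union> depots I"

text \<open>
  The graph is complete and simple, so its edges are the pairs of distinct vertices and
  \<open>weight\<close> is meaningful off the diagonal only; the diagonal is fixed to 0.
\<close>

definition mcvrp_instance :: "'v mcvrp \<Rightarrow> bool" where
  "mcvrp_instance I \<longleftrightarrow>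
     finite (customers I) \<and> finite (depots I) \<and> depots I \<noteq> {} \<and>
     customers I \<inter> depots I = {} \<and>
     (\<forall>x\<in>vertices I. weight I x x = 0) \<and>
     (\<forall>x\<in>vertices I. \<forall>y\<in>vertices I. weight I x y = weight I y x) \<and>
     (\<forall>x\<in>vertices I. \<forall>y\<in>vertices I. 0 \<le> weight I x y) \<and>
     (\<forall>x\<in>vertices I. \<forall>y\<in>vertices I. \<forall>z\<in>vertices I.
        weight I x z \<le> weight I x y + weight I y z) \<and>
     (\<forall>v\<in>customers I. 1 \<le> demand I v) \<and>
     1 \<le> capacity I"

definition variant_instance :: "problem_variant \<Rightarrow> 'v mcvrp \<Rightarrow> bool" where
  "variant_instance \<nu> I \<longleftrightarrow>
     mcvrp_instance I \<and> (\<nu> = Unit_Demand \<longrightarrow> (\<forall>v\<in>customers I. demand I v = 1))"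

text \<open>
  A walk is given by its vertex sequence, the depot being both first and last entry;
  \<open>deliver \<tau> v\<close> is the number of units that \<open>\<tau>\<close> brings to \<open>v\<close>.
\<close>

record 'v tour =
  walk :: "'v list"
  deliver :: "'v \<Rightarrow> nat"

definition is_tour :: "'v mcvrp \<Rightarrow> 'v tour \<Rightarrow> bool" where
  "is_tour I \<tau> \<longleftrightarrow>
     walk \<tau> \<noteq> [] \<and> hd (walk \<tau>) \<in> depots I \<and> last (walk \<tau>) = hd (walk \<tau>) \<and>
     set (walk \<tau>) \<subseteq> customers I \<union> {hd (walk \<tau>)} \<and>
     successively (\<noteq>) (walk \<tau>) \<and>
     (\<forall>v. deliver \<tau> v \<noteq> 0 \<longrightarrow> v \<in> customers I \<and> v \<in> set (walk \<tau>)) \<and>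
     (\<Sum>v\<in>customers I. deliver \<tau> v) \<le> capacity I"

definition feasible :: "problem_variant \<Rightarrow> 'v mcvrp \<Rightarrow> 'v tour list \<Rightarrow> bool" where
  "feasible \<nu> I sol \<longleftrightarrow>
     (\<forall>\<tau>\<in>set sol. is_tour I \<tau>) \<and>
     (\<forall>v\<in>customers I. (\<Sum>\<tau>\<leftarrow>sol. deliver \<tau> v) = demand I v) \<and>
     (\<nu> = Unsplittable \<longrightarrow> (\<forall>v\<in>customers I. \<exists>\<tau>\<in>set sol. deliver \<tau> v = demand I v))"

definition walk_cost :: "'v mcvrp \<Rightarrow> 'v list \<Rightarrow> real" where
  "walk_cost I p = (\<Sum>i<length p - 1. weight I (p ! i) (p ! Suc i))"

definition solution_cost :: "'v mcvrp \<Rightarrow> 'v tour list \<Rightarrow> real" where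
  "solution_cost I sol = (\<Sum>\<tau>\<leftarrow>sol. walk_cost I (walk \<tau>))"

section \<open>The auxiliary graph \<open>H\<close>\<close>

text \<open>The merged depot \<open>o\<close> is \<open>None\<close>, a customer \<open>v\<close> is \<open>Some v\<close>.\<close>

definition depot_dist :: "'v mcvrp \<Rightarrow> 'v \<Rightarrow> real" where
  "depot_dist I v = Min ((\<lambda>u. weight I u v) ` depots I)"

fun aux_weight :: "'v mcvrp \<Rightarrow> 'v option \<Rightarrow> 'v option \<Rightarrow> real" where
  "aux_weight I None None = 0"
| "aux_weight I None (Some v) = depot_dist I v"
| "aux_weight I (Some v) None = depot_dist I v"
| "aux_weight I (Some v) (Some v') = min (depot_dist I v + depot_dist I v') (weight I v v')"

definition aux_vertices :: "'v mcvrp \<Rightarrow> 'v option set" where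
  "aux_vertices I = insert None (Some ` customers I)"

definition aux_edges :: "'v mcvrp \<Rightarrow> 'v option set set" where
  "aux_edges I = {{x, y} |x y. x \<in> aux_vertices I \<and> y \<in> aux_vertices I \<and> x \<noteq> y}"

definition edges_weight :: "('a \<Rightarrow> 'a \<Rightarrow> real) \<Rightarrow> 'a set set \<Rightarrow> real" where
  "edges_weight c T = (\<Sum>e\<in>T. THE r. \<exists>x y. e = {x, y} \<and> r = c x y)"

definition Delta :: "'v mcvrp \<Rightarrow> real" where
  "Delta I = (\<Sum>v\<in>customers I. real (demand I v) * aux_weight I None (Some v))"

section \<open>Spanning trees of undirected graphs\<close>

definition induced_edges :: "'a set set \<Rightarrow> 'a set \<Rightarrow> 'a set set" where
  "induced_edges E S = {e \<in> E. e \<subseteq> S}"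

definition graph_connected :: "'a set \<Rightarrow> 'a set set \<Rightarrow> bool" where
  "graph_connected S E \<longleftrightarrow> (\<forall>x\<in>S. \<forall>y\<in>S. (x, y) \<in> {(a, b). {a, b} \<in> E}\<^sup>*)"

definition is_cycle :: "'a set set \<Rightarrow> 'a list \<Rightarrow> bool" where
  "is_cycle E p \<longleftrightarrow>
     3 \<le> length p \<and> distinct p \<and> successively (\<lambda>x y. {x, y} \<in> E) p \<and> {last p, hd p} \<in> E"

definition spanning_tree :: "'a set \<Rightarrow> 'a set set \<Rightarrow> 'a set set \<Rightarrow> bool" where
  "spanning_tree S E T \<longleftrightarrow> T \<subseteq> E \<and> graph_connected S T \<and> \<not> (\<exists>p. is_cycle T p)"

definition min_spanning_tree ::
    "('a \<Rightarrow> 'a \<Rightarrow> real) \<Rightarrow> 'a set \<Rightarrow> 'a set set \<Rightarrow> 'a set set \<Rightarrow> bool" where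
  "min_spanning_tree c S E T \<longleftrightarrow>
     spanning_tree S E T \<and>
     (\<forall>T'. spanning_tree S E T' \<longrightarrow> edges_weight c T \<le> edges_weight c T')"

definition small_customers :: "'v mcvrp \<Rightarrow> 'v set" where
  "small_customers I = {v \<in> customers I. demand I v \<le> capacity I div 2}"

definition small_min_spanning_tree :: "'v mcvrp \<Rightarrow> 'v option set set \<Rightarrow> bool" where
  "small_min_spanning_tree I T \<longleftrightarrow>
     (let S = insert None (Some ` small_customers I)
      in min_spanning_tree (aux_weight I) S (induced_edges (aux_edges I) S) T)"

section \<open>Algorithms and running time\<close>

text \<open>
  Edge weights are real numbers, so algorithms are programs of a random access machine whose
  memory has natural number cells and real number cells (all initially 0 except for the input).
  A cell is addressed by an array name and two indices. The available arithmetic is addition,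
  (truncated) subtraction and comparison, at unit cost. There is no multiplication, so the
  bit length of natural numbers grows by at most a constant per step, and for rational weights
  the uniform cost measure is polynomially related to Turing machine time.
  An expression is charged together with the command that evaluates it: the size of the
  expressions is bounded by a constant of the program.
\<close>

record state =
  nmem :: "nat \<times> nat \<times> nat \<Rightarrow> nat"
  rmem :: "nat \<times> nat \<times> nat \<Rightarrow> real"

datatype nexp = NConst nat | NCell nat nexp nexp | NAdd nexp nexp | NSub nexp nexp
datatype rexp = RCell nat nexp nexp | RAdd rexp rexp | RSub rexp rexp
datatype bexp = NLess nexp nexp | RLess rexp rexp | BNot bexp | BAnd bexp bexp

datatype com =
    Skip
  | NAssign nat nexp nexp nexp
  | RAssign nat nexp nexp rexp
  | Seq com com
  | Cond bexp com com
  | While bexp com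

fun nval :: "nexp \<Rightarrow> state \<Rightarrow> nat" where
  "nval (NConst n) s = n"
| "nval (NCell a i j) s = nmem s (a, nval i s, nval j s)"
| "nval (NAdd e e') s = nval e s + nval e' s"
| "nval (NSub e e') s = nval e s - nval e' s"

fun rval :: "rexp \<Rightarrow> state \<Rightarrow> real" where
  "rval (RCell a i j) s = rmem s (a, nval i s, nval j s)"
| "rval (RAdd e e') s = rval e s + rval e' s"
| "rval (RSub e e') s = rval e s - rval e' s"

fun bval :: "bexp \<Rightarrow> state \<Rightarrow> bool" where
  "bval (NLess e e') s \<longleftrightarrow> nval e s < nval e' s"
| "bval (RLess e e') s \<longleftrightarrow> rval e s < rval e' s"
| "bval (BNot b) s \<longleftrightarrow> \<not> bval b s"
| "bval (BAnd b b') s \<longleftrightarrow> bval b s \<and> bval b' s"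

text \<open>\<open>exec P s t s'\<close>: started in \<open>s\<close>, program \<open>P\<close> halts after \<open>t\<close> steps in \<open>s'\<close>.\<close>

inductive exec :: "com \<Rightarrow> state \<Rightarrow> nat \<Rightarrow> state \<Rightarrow> bool" where
  exec_Skip: "exec Skip s 1 s"
| exec_NAssign:
    "exec (NAssign a i j e) s 1 (s\<lparr>nmem := (nmem s)((a, nval i s, nval j s) := nval e s)\<rparr>)"
| exec_RAssign:
    "exec (RAssign a i j e) s 1 (s\<lparr>rmem := (rmem s)((a, nval i s, nval j s) := rval e s)\<rparr>)"
| exec_Seq: "exec P s t s' \<Longrightarrow> exec Q s' t' s'' \<Longrightarrow> exec (Seq P Q) s (t + t') s''"
| exec_CondTrue: "bval b s \<Longrightarrow> exec P s t s' \<Longrightarrow> exec (Cond b P Q) s (1 + t) s'"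
| exec_CondFalse: "\<not> bval b s \<Longrightarrow> exec Q s t s' \<Longrightarrow> exec (Cond b P Q) s (1 + t) s'"
| exec_WhileFalse: "\<not> bval b s \<Longrightarrow> exec (While b P) s 1 s"
| exec_WhileTrue:
    "bval b s \<Longrightarrow> exec P s t s' \<Longrightarrow> exec (While b P) s' t' s'' \<Longrightarrow>
     exec (While b P) s (1 + t + t') s''"

inductive_cases exec_SkipE: "exec Skip s t s'"
inductive_cases exec_NAssignE: "exec (NAssign a i j e) s t s'"
inductive_cases exec_RAssignE: "exec (RAssign a i j e) s t s'"
inductive_cases exec_SeqE: "exec (Seq P Q) s t s'"
inductive_cases exec_CondE: "exec (Cond b P Q) s t s'"
inductive_cases exec_WhileE: "exec (While b P) s t s'"

lemma exec_deterministic: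
  "exec P s t s' \<Longrightarrow> exec P s u s'' \<Longrightarrow> u = t \<and> s'' = s'"
proof (induction arbitrary: u s'' rule: exec.induct)
  case exec_Skip
  then show ?case by (auto elim: exec_SkipE)
next
  case exec_NAssign
  then show ?case by (auto elim: exec_NAssignE)
next
  case exec_RAssign
  then show ?case by (auto elim: exec_RAssignE)
next
  case exec_Seq
  from exec_Seq.prems show ?case
    by (rule exec_SeqE) (metis exec_Seq.IH)
next
  case exec_CondTrue
  from exec_CondTrue.prems show ?case
    by (rule exec_CondE) (use exec_CondTrue.IH exec_CondTrue.hyps in fastforce)+
next
  case exec_CondFalse
  from exec_CondFalse.prems show ?case
    by (rule exec_CondE) (use exec_CondFalse.IH exec_CondFalse.hyps in fastforce)+
next
  case exec_WhileFalse
  from exec_WhileFalse.prems show ?case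
    by (rule exec_WhileE) (use exec_WhileFalse.hyps in auto)
next
  case exec_WhileTrue
  from exec_WhileTrue.prems show ?case
    by (rule exec_WhileE) (use exec_WhileTrue.IH exec_WhileTrue.hyps in fastforce)+
qed

text \<open>
  A presentation of an instance enumerates the customers as \<open>vs\<close> and the depots as \<open>ds\<close>;
  the program refers to a vertex by its position in \<open>vs @ ds\<close>.
  Input: the numbers of customers and depots and the capacity are in the natural number
  cells \<open>(0,0,0)\<close>, \<open>(0,0,1)\<close>, \<open>(0,0,2)\<close>, the demand of customer \<open>i\<close> is in \<open>(1,i,0)\<close>, and the
  weight between vertices \<open>i\<close> and \<open>j\<close> is in the real number cell \<open>(0,i,j)\<close>.
\<close>

definition presentation :: "'v mcvrp \<Rightarrow> 'v list \<Rightarrow> 'v list \<Rightarrow> bool" where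
  "presentation I vs ds \<longleftrightarrow>
     distinct vs \<and> set vs = customers I \<and> distinct ds \<and> set ds = depots I"

definition input_state :: "'v mcvrp \<Rightarrow> 'v list \<Rightarrow> 'v list \<Rightarrow> state" where
  "input_state I vs ds =
     \<lparr>nmem = (\<lambda>(a, i, j).
        if (a, i, j) = (0, 0, 0) then length vs
        else if (a, i, j) = (0, 0, 1) then length ds
        else if (a, i, j) = (0, 0, 2) then capacity I
        else if a = 1 \<and> i < length vs \<and> j = 0 then demand I (vs ! i)
        else 0),
      rmem = (\<lambda>(a, i, j).
        if a = 0 \<and> i < length (vs @ ds) \<and> j < length (vs @ ds)
        then weight I ((vs @ ds) ! i) ((vs @ ds) ! j)
        else 0)\<rparr>"

text \<open>
  Output: the number of tours is in \<open>(2,0,0)\<close>; for tour number \<open>t\<close>, the length of its vertex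
  sequence is in \<open>(3,t,0)\<close>, the \<open>q\<close>-th vertex of that sequence in \<open>(4,t,q)\<close>, and the amount
  delivered to customer \<open>i\<close> in \<open>(5,t,i)\<close>. A walk is nonempty and does not stay at a vertex, so
  by the initialisation of the cells the size of a feasible output is bounded by the running time.
\<close>

definition outputs :: "state \<Rightarrow> 'v list \<Rightarrow> 'v list \<Rightarrow> 'v tour list \<Rightarrow> bool" where
  "outputs s vs ds sol \<longleftrightarrow>
     length sol = nmem s (2, 0, 0) \<and>
     (\<forall>t<length sol.
        length (walk (sol ! t)) = nmem s (3, t, 0) \<and>
        (\<forall>q<length (walk (sol ! t)).
           nmem s (4, t, q) < length (vs @ ds) \<and>
           walk (sol ! t) ! q = (vs @ ds) ! nmem s (4, t, q)) \<and>
        (\<forall>i<length vs. deliver (sol ! t) (vs ! i) = nmem s (5, t, i)))"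

text \<open>
  Natural numbers are measured by their binary length; each of the weights counts as one unit,
  being a single real number.
\<close>

definition instance_size :: "'v mcvrp \<Rightarrow> nat" where
  "instance_size I =
     (card (vertices I))\<^sup>2 + (\<Sum>v\<in>customers I. floor_log (demand I v) + 1)
     + (floor_log (capacity I) + 1)"

end

theory Submission
  imports Defs
begin

text \<open>
  Grow a tree from the merged depot by Prim's algorithm, where a customer may be attached to the depot
  at cost \<open>c(o,v)\<close> and a customer with \<open>2 d(v) \<le> k\<close> also to another such customer at the original
  cost \<open>w(u,v)\<close>. On the small customers the tree costs at most as much as a spanning tree with respect
  to \<open>c\<close>, although its edges are genuine edges of the input graph: an edge of \<open>c\<close>-weight
  \<open>c(o,u) + c(o,v)\<close> that leaves the visited set is never cheaper than the depot edge of its unvisited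
  end.

  Process the customers in reverse Prim order, each carrying a bag: a closed walk through it, with
  the demands that this walk will serve. A processed customer merges its bag into that of its
  parent, along the doubled tree edge. Bags of small customers have load at most \<open>k/2\<close>, so a merged
  bag fits into one vehicle; if its load exceeds \<open>k/2\<close> it is emitted as a tour, and the detour to the
  depot nearest to the walk costs at most \<open>2/(\<lfloor>k/2\<rfloor> + 1)\<close> times the sum of \<open>d(v) c(o,v)\<close> over
  the served customers. A bag at a child of the depot is emitted along the doubled depot edge.
  A large customer is a child of the depot whose bag is already heavy. No demand is ever split.
\<close>

section \<open>Step-counted total correctness\<close>

definition runs :: "com \<Rightarrow> state \<Rightarrow> nat \<Rightarrow> (state \<Rightarrow> bool) \<Rightarrow> bool" where
  "runs P s T Q \<longleftrightarrow> (\<exists>t s'. exec P s t s' \<and> t \<le> T \<and> Q s')"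

lemma runs_mono: "runs P s T Q \<Longrightarrow> T \<le> T' \<Longrightarrow> (\<And>s'. Q s' \<Longrightarrow> Q' s') \<Longrightarrow> runs P s T' Q'"
  unfolding runs_def by (meson le_trans)

lemma runs_Skip: "Q s \<Longrightarrow> 1 \<le> T \<Longrightarrow> runs Skip s T Q"
  unfolding runs_def by (meson exec_Skip)

lemma runs_Seq:
  assumes "runs P s T R" and "\<And>s'. R s' \<Longrightarrow> runs P' s' T' Q"
  shows "runs (Seq P P') s (T + T') Q"
proof -
  obtain t s' where P: "exec P s t s'" "t \<le> T" "R s'"
    using assms(1) unfolding runs_def by blast
  obtain t' s'' where "exec P' s' t' s''" "t' \<le> T'" "Q s''"
    using assms(2)[OF P(3)] unfolding runs_def by blast
  with P show ?thesis
    unfolding runs_def by (meson exec_Seq add_mono)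
qed

lemma runs_Cond:
  assumes "bval b s \<Longrightarrow> runs P s (T - 1) Q" and "\<not> bval b s \<Longrightarrow> runs P' s (T - 1) Q" and "1 \<le> T"
  shows "runs (Cond b P P') s T Q"
proof -
  obtain t s' where "exec (Cond b P P') s (1 + t) s'" "t \<le> T - 1" "Q s'"
    using assms(1,2) exec_CondTrue exec_CondFalse unfolding runs_def by (cases "bval b s") blast+
  moreover have "1 + t \<le> T"
    using \<open>t \<le> T - 1\<close> \<open>1 \<le> T\<close> by simp
  ultimately show ?thesis
    unfolding runs_def by blast
qed

lemma runs_While:
  assumes "Q 0 s"
    and step: "\<And>i s. i < N \<Longrightarrow> Q i s \<Longrightarrow> bval b s \<and> runs P s T (Q (Suc i))"
    and exit: "\<And>s. Q N s \<Longrightarrow> \<not> bval b s"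
  shows "runs (While b P) s (1 + N * (T + 1)) (Q N)"
proof -
  have "runs (While b P) s (1 + (N - i) * (T + 1)) (Q N)" if "i \<le> N" "Q i s" for i s
    using that
  proof (induction i arbitrary: s rule: inc_induct)
    case base
    then have "exec (While b P) s 1 s"
      using exit exec_WhileFalse by blast
    then show ?case
      using base unfolding runs_def by auto
  next
    case (step i)
    then obtain t s' where P: "bval b s" "exec P s t s'" "t \<le> T" "Q (Suc i) s'"
      using assms(2) unfolding runs_def by blast
    then obtain t' s'' where W: "exec (While b P) s' t' s''"
        "t' \<le> 1 + (N - Suc i) * (T + 1)" "Q N s''"
      using step.IH unfolding runs_def by blast
    have "N - i = Suc (N - Suc i)"
      using step.hyps by simp
    then have "1 + t + t' \<le> 1 + (N - i) * (T + 1)"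
      using P(3) W(2) by simp
    then show ?case
      using exec_WhileTrue[OF P(1,2) W(1)] W(3) unfolding runs_def by blast
  qed
  from this[of 0 s] show ?thesis
    using assms(1) by simp
qed

section \<open>Named arrays\<close>

text \<open>A scalar variable is an array of which only the cell \<open>(0, 0)\<close> is used.\<close>

datatype narray =
    Header | Demand | Tour_Count | Tour_Length | Tour_Walk | Tour_Units
  | Outer | Inner | Selected | Processed | Target | Position
  | Visited | Order | Parent | Nearest_Depot | Load | Route_Length | Route | Units

datatype rarray = Weight | Depot_Dist | Key

primrec narray_code :: "narray \<Rightarrow> nat" where
  "narray_code Header = 0"
| "narray_code Demand = 1"
| "narray_code Tour_Count = 2"
| "narray_code Tour_Length = 3"
| "narray_code Tour_Walk = 4"
| "narray_code Tour_Units = 5"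
| "narray_code Outer = 6"
| "narray_code Inner = 7"
| "narray_code Selected = 8"
| "narray_code Processed = 9"
| "narray_code Target = 10"
| "narray_code Position = 11"
| "narray_code Visited = 12"
| "narray_code Order = 13"
| "narray_code Parent = 14"
| "narray_code Nearest_Depot = 15"
| "narray_code Load = 16"
| "narray_code Route_Length = 17"
| "narray_code Route = 18"
| "narray_code Units = 19"

primrec rarray_code :: "rarray \<Rightarrow> nat" where
  "rarray_code Weight = 0"
| "rarray_code Depot_Dist = 1"
| "rarray_code Key = 2"

declare narray_code.simps [simp del] rarray_code.simps [simp del]

lemma narray_code_eq_iff: "narray_code a = narray_code b \<longleftrightarrow> a = b"
  by (cases a; cases b) (simp_all add: narray_code.simps)

lemma rarray_code_eq_iff: "rarray_code a = rarray_code b \<longleftrightarrow> a = b"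
  by (cases a; cases b) (simp_all add: rarray_code.simps)

definition narr :: "state \<Rightarrow> narray \<Rightarrow> nat \<Rightarrow> nat \<Rightarrow> nat" where
  "narr s a i j = nmem s (narray_code a, i, j)"

definition rarr :: "state \<Rightarrow> rarray \<Rightarrow> nat \<Rightarrow> nat \<Rightarrow> real" where
  "rarr s a i j = rmem s (rarray_code a, i, j)"

abbreviation nvar :: "state \<Rightarrow> narray \<Rightarrow> nat" where
  "nvar s x \<equiv> narr s x 0 0"

lemma cell_eq_array [simp]:
  "nmem s (narray_code a, i, j) = narr s a i j"
  "rmem s (rarray_code b, i, j) = rarr s b i j"
  by (simp_all add: narr_def rarr_def)

definition set_narr :: "narray \<Rightarrow> nat \<Rightarrow> nat \<Rightarrow> nat \<Rightarrow> state \<Rightarrow> state" where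
  "set_narr a i j x s = s\<lparr>nmem := (nmem s)((narray_code a, i, j) := x)\<rparr>"

definition set_rarr :: "rarray \<Rightarrow> nat \<Rightarrow> nat \<Rightarrow> real \<Rightarrow> state \<Rightarrow> state" where
  "set_rarr a i j x s = s\<lparr>rmem := (rmem s)((rarray_code a, i, j) := x)\<rparr>"

lemma arrays_set_narr [simp]:
  "narr (set_narr a i j x s) = (narr s)(a := (narr s a)(i := (narr s a i)(j := x)))"
  "rarr (set_narr a i j x s) = rarr s"
  by (auto simp: narr_def rarr_def set_narr_def narray_code_eq_iff fun_eq_iff simp del: cell_eq_array)

lemma arrays_set_rarr [simp]:
  "rarr (set_rarr a i j x s) = (rarr s)(a := (rarr s a)(i := (rarr s a i)(j := x)))"
  "narr (set_rarr a i j x s) = narr s"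
  by (auto simp: narr_def rarr_def set_rarr_def rarray_code_eq_iff fun_eq_iff simp del: cell_eq_array)

definition modifies :: "narray set \<Rightarrow> rarray set \<Rightarrow> state \<Rightarrow> state \<Rightarrow> bool" where
  "modifies A R s s' \<longleftrightarrow> (\<forall>a. a \<notin> A \<longrightarrow> narr s' a = narr s a) \<and> (\<forall>a. a \<notin> R \<longrightarrow> rarr s' a = rarr s a)"

lemma modifies_refl [simp]: "modifies A R s s"
  by (simp add: modifies_def)

lemma modifies_trans:
  "modifies A R s s' \<Longrightarrow> modifies B S s' s'' \<Longrightarrow> A \<subseteq> C \<Longrightarrow> B \<subseteq> C \<Longrightarrow> R \<subseteq> U \<Longrightarrow> S \<subseteq> U \<Longrightarrow> modifies C U s s''"
  unfolding modifies_def by (metis subsetD)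

lemma modifies_set [simp]:
  "a \<in> A \<Longrightarrow> modifies A R s (set_narr a i j x s') \<longleftrightarrow> modifies A R s s'"
  "b \<in> R \<Longrightarrow> modifies A R s (set_rarr b i j y s') \<longleftrightarrow> modifies A R s s'"
  unfolding modifies_def by auto

section \<open>Assignments and loops\<close>

notation Seq (infixr \<open>;;\<close> 60)

abbreviation NArr2 :: "narray \<Rightarrow> nexp \<Rightarrow> nexp \<Rightarrow> nexp" where
  "NArr2 a \<equiv> NCell (narray_code a)"
abbreviation NArr :: "narray \<Rightarrow> nexp \<Rightarrow> nexp" where
  "NArr a i \<equiv> NArr2 a i (NConst 0)"
abbreviation Var :: "narray \<Rightarrow> nexp" where
  "Var x \<equiv> NArr x (NConst 0)"
abbreviation RArr2 :: "rarray \<Rightarrow> nexp \<Rightarrow> nexp \<Rightarrow> rexp" where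
  "RArr2 a \<equiv> RCell (rarray_code a)"
abbreviation RArr :: "rarray \<Rightarrow> nexp \<Rightarrow> rexp" where
  "RArr a i \<equiv> RArr2 a i (NConst 0)"
abbreviation NPut2 :: "narray \<Rightarrow> nexp \<Rightarrow> nexp \<Rightarrow> nexp \<Rightarrow> com" where
  "NPut2 a \<equiv> NAssign (narray_code a)"
abbreviation NPut :: "narray \<Rightarrow> nexp \<Rightarrow> nexp \<Rightarrow> com" where
  "NPut a i \<equiv> NPut2 a i (NConst 0)"
abbreviation SetVar :: "narray \<Rightarrow> nexp \<Rightarrow> com" where
  "SetVar x \<equiv> NPut x (NConst 0)"
abbreviation RPut :: "rarray \<Rightarrow> nexp \<Rightarrow> rexp \<Rightarrow> com" where
  "RPut a i \<equiv> RAssign (rarray_code a) i (NConst 0)"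

lemma runs_NPut:
  "Q (set_narr a (nval i s) (nval j s) (nval e s) s) \<Longrightarrow> 1 \<le> T \<Longrightarrow> runs (NPut2 a i j e) s T Q"
  unfolding runs_def set_narr_def using exec_NAssign by blast

lemma runs_RPut:
  "Q (set_rarr a (nval i s) 0 (rval e s) s) \<Longrightarrow> 1 \<le> T \<Longrightarrow> runs (RPut a i e) s T Q"
  unfolding runs_def set_rarr_def using exec_RAssign[of "rarray_code a" i "NConst 0"] by auto

lemma runs_NPut_Seq:
  assumes "runs P (set_narr a (nval i s) (nval j s) (nval e s) s) (T - 1) Q" "1 \<le> T"
  shows "runs (NPut2 a i j e ;; P) s T Q"
proof -
  have "runs (NPut2 a i j e ;; P) s (1 + (T - 1)) Q"
    by (rule runs_Seq[where R = "(=) (set_narr a (nval i s) (nval j s) (nval e s) s)"])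
      (use assms in \<open>auto intro: runs_NPut\<close>)
  then show ?thesis
    using assms(2) by simp
qed

lemma runs_RPut_Seq:
  assumes "runs P (set_rarr a (nval i s) 0 (rval e s) s) (T - 1) Q" "1 \<le> T"
  shows "runs (RPut a i e ;; P) s T Q"
proof -
  have "runs (RPut a i e ;; P) s (1 + (T - 1)) Q"
    by (rule runs_Seq[where R = "(=) (set_rarr a (nval i s) 0 (rval e s) s)"])
      (use assms in \<open>auto intro: runs_RPut\<close>)
  then show ?thesis
    using assms(2) by simp
qed

lemmas runs_assign = runs_NPut_Seq runs_RPut_Seq runs_NPut runs_RPut

definition For :: "narray \<Rightarrow> nexp \<Rightarrow> com \<Rightarrow> com" where
  "For x e P = SetVar x (NConst 0) ;;
     While (NLess (Var x) e) (P ;; SetVar x (NAdd (Var x) (NConst 1)))"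

lemma runs_For:
  assumes counter: "\<And>i j s. Q i s \<Longrightarrow> Q i (set_narr x 0 0 j s)"
    and init: "Q 0 s"
    and step: "\<And>i s. i < N \<Longrightarrow> Q i s \<Longrightarrow> nvar s x = i \<Longrightarrow> runs P s T (\<lambda>s'. nvar s' x = i \<and> Q (Suc i) s')"
    and bound: "\<And>i s. i \<le> N \<Longrightarrow> Q i s \<Longrightarrow> nval e s = N"
  shows "runs (For x e P) s (2 + N * (T + 2)) (Q N)"
proof -
  let ?inc = "SetVar x (NAdd (Var x) (NConst 1))"
  let ?s = "set_narr x 0 0 0 s"
  have "runs (While (NLess (Var x) e) (P ;; ?inc)) ?s (1 + N * ((T + 1) + 1))
    (\<lambda>s'. nvar s' x = N \<and> Q N s')"
  proof (rule runs_While[where Q = "\<lambda>i s. nvar s x = i \<and> Q i s"])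
    show "nvar ?s x = 0 \<and> Q 0 ?s"
      using counter init by simp
    show "bval (NLess (Var x) e) s \<and> runs (P ;; ?inc) s (T + 1) (\<lambda>s'. nvar s' x = Suc i \<and> Q (Suc i) s')"
      if i: "i < N" and Q: "nvar s x = i \<and> Q i s" for i s
    proof
      show "bval (NLess (Var x) e) s"
        using i Q bound[of i s] by simp
      have "runs P s T (\<lambda>s'. nvar s' x = i \<and> Q (Suc i) s')"
        using step i Q by simp
      then show "runs (P ;; ?inc) s (T + 1) (\<lambda>s'. nvar s' x = Suc i \<and> Q (Suc i) s')"
        by (rule runs_Seq) (auto intro!: runs_NPut counter)
    qed
    show "\<not> bval (NLess (Var x) e) s" if "nvar s x = N \<and> Q N s" for s
      using that bound[of N s] by simp
  qed
  then have "runs (For x e P) s (2 + N * (T + 2)) (\<lambda>s'. nvar s' x = N \<and> Q N s')"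
    unfolding For_def by (intro runs_NPut_Seq) auto
  then show ?thesis
    by (rule runs_mono) auto
qed

definition fill_row :: "nat \<Rightarrow> nat \<Rightarrow> (nat \<Rightarrow> 'a) \<Rightarrow> nat \<Rightarrow> (nat \<Rightarrow> nat \<Rightarrow> 'a) \<Rightarrow> nat \<Rightarrow> nat \<Rightarrow> 'a" where
  "fill_row r l f N M = M(r := (\<lambda>q. if l \<le> q \<and> q < l + N then f (q - l) else M r q))"

lemma fill_row_0 [simp]: "fill_row r l f 0 M = M"
  by (auto simp: fill_row_def fun_eq_iff)

lemma fill_row_Suc:
  "fill_row r l f (Suc i) M = (fill_row r l f i M)(r := (fill_row r l f i M r)(l + i := f i))"
  by (auto simp: fill_row_def fun_eq_iff)

definition fill_com :: "narray \<Rightarrow> nexp \<Rightarrow> nexp \<Rightarrow> nexp \<Rightarrow> nexp \<Rightarrow> com" where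
  "fill_com a r l N e = For Inner N (NPut2 a r (NAdd l (Var Inner)) e)"

lemma runs_fill:
  assumes a: "a \<noteq> Inner"
    and eval: "\<And>i s'. modifies {Inner, a} {} s s' \<Longrightarrow> narr s' a = fill_row r l f i (narr s a) \<Longrightarrow>
      nval re s' = r \<and> nval le s' = l \<and> nval Ne s' = N \<and> (i < N \<and> nvar s' Inner = i \<longrightarrow> nval e s' = f i)"
  shows "runs (fill_com a re le Ne e) s (2 + N * 3)
    (\<lambda>s'. modifies {Inner, a} {} s s' \<and> narr s' a = fill_row r l f N (narr s a))"
proof -
  let ?Q = "\<lambda>i s'. modifies {Inner, a} {} s s' \<and> narr s' a = fill_row r l f i (narr s a)"
  have "runs (fill_com a re le Ne e) s (2 + N * (1 + 2)) (?Q N)"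
    unfolding fill_com_def
  proof (rule runs_For[where Q = ?Q])
    fix i t
    assume t: "i < N" "?Q i t" "nvar t Inner = i"
    then have "nval re t = r" "nval le t = l" "nval e t = f i"
      using eval[of t i] by auto
    then show "runs (NPut2 a re (NAdd le (Var Inner)) e) t 1 (\<lambda>s'. nvar s' Inner = i \<and> ?Q (Suc i) s')"
      using t a by (intro runs_NPut) (simp_all add: fill_row_Suc)
  qed (use a eval in auto)
  then show ?thesis
    by (rule runs_mono) simp_all
qed

text \<open>The value \<open>N\<close> of \<open>x\<close> means that no candidate has been seen yet.\<close>

definition argmin_com :: "narray \<Rightarrow> nexp \<Rightarrow> (nexp \<Rightarrow> bexp) \<Rightarrow> (nexp \<Rightarrow> rexp) \<Rightarrow> com" where
  "argmin_com x N p f = SetVar x N ;;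
     For Inner N
      (Cond (BAnd (p (Var Inner))
          (BNot (BAnd (NLess (Var x) N) (BNot (RLess (f (Var Inner)) (f (Var x)))))))
        (SetVar x (Var Inner)) Skip)"

lemma runs_argmin:
  assumes x: "x \<noteq> Inner" and ex: "\<exists>i<N. p i"
    and eval: "\<And>s' j. modifies {Inner, x} {} s s' \<Longrightarrow>
      nval Ne s' = N \<and> bval (pe j) s' = p (nval j s') \<and> rval (fe j) s' = f (nval j s')"
  shows "runs (argmin_com x Ne pe fe) s (3 + N * 4)
    (\<lambda>s'. modifies {Inner, x} {} s s' \<and> is_arg_min f (\<lambda>i. i < N \<and> p i) (nvar s' x))"
proof -
  let ?test = "BAnd (pe (Var Inner))
    (BNot (BAnd (NLess (Var x) Ne) (BNot (RLess (fe (Var Inner)) (fe (Var x))))))"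
  let ?Q = "\<lambda>i s'. modifies {Inner, x} {} s s' \<and>
    (if nvar s' x < N then p (nvar s' x) \<and> (\<forall>j<i. p j \<longrightarrow> f (nvar s' x) \<le> f j) else \<forall>j<i. \<not> p j)"
  let ?s = "set_narr x 0 0 N s"
  have "runs (For Inner Ne (Cond ?test (SetVar x (Var Inner)) Skip)) ?s (2 + N * (2 + 2)) (?Q N)"
  proof (rule runs_For[where Q = ?Q])
    fix i t
    assume i: "i < N" and Q: "?Q i t" and t: "nvar t Inner = i"
    then have test: "bval ?test t \<longleftrightarrow> p i \<and> \<not> (nvar t x < N \<and> f (nvar t x) \<le> f i)"
      using eval[of t] by auto
    show "runs (Cond ?test (SetVar x (Var Inner)) Skip) t 2 (\<lambda>s'. nvar s' Inner = i \<and> ?Q (Suc i) s')"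
    proof (rule runs_Cond)
      assume "bval ?test t"
      then have "p i" "nvar t x < N \<Longrightarrow> f i < f (nvar t x)"
        using test by auto
      then have "\<forall>j<Suc i. p j \<longrightarrow> f i \<le> f j"
        using Q by (fastforce simp: less_Suc_eq split: if_splits)
      then show "runs (SetVar x (Var Inner)) t (2 - 1) (\<lambda>s'. nvar s' Inner = i \<and> ?Q (Suc i) s')"
        using Q t i x \<open>p i\<close> by (intro runs_NPut) auto
    next
      assume "\<not> bval ?test t"
      then show "runs Skip t (2 - 1) (\<lambda>s'. nvar s' Inner = i \<and> ?Q (Suc i) s')"
        using Q t test by (intro runs_Skip) (auto simp: less_Suc_eq)
    qed simp
  qed (use x eval in auto)
  then have "runs (argmin_com x Ne pe fe) s (3 + N * 4) (?Q N)"
    unfolding argmin_com_def by (intro runs_NPut_Seq) (use eval[of s] in simp_all)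
  then show ?thesis
    by (rule runs_mono) (use ex in \<open>auto simp: is_arg_min_linorder split: if_splits\<close>)
qed

section \<open>A greedy lower bound for connecting edge sets\<close>

definition adj :: "'a set set \<Rightarrow> ('a \<times> 'a) set" where
  "adj T = {(a, b). {a, b} \<in> T}"

lemma rtrancl_adj_sym: "(x, y) \<in> (adj T)\<^sup>* \<Longrightarrow> (y, x) \<in> (adj T)\<^sup>*"
  by (rule symD[OF sym_rtrancl]) (auto simp: adj_def sym_def insert_commute)

lemma rtrancl_adj_mono: "T \<subseteq> T' \<Longrightarrow> (x, y) \<in> (adj T)\<^sup>* \<Longrightarrow> (x, y) \<in> (adj T')\<^sup>*"
  using rtrancl_mono[of "adj T" "adj T'"] by (auto simp: adj_def)

lemma rtrancl_adj_first_entry: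
  assumes "(x, a) \<in> (adj T)\<^sup>*" "a \<in> A" "x \<notin> A"
  obtains y y' where "y \<notin> A" "y' \<in> A" "{y, y'} \<in> T" "(x, y) \<in> (adj (T - {{y, y'}}))\<^sup>*"
proof -
  let ?T = "{e \<in> T. e \<inter> A = {}}"
  have "\<exists>y y'. y \<notin> A \<and> y' \<in> A \<and> {y, y'} \<in> T \<and> (x, y) \<in> (adj ?T)\<^sup>*"
    using assms(1,3)
  proof (induction rule: converse_rtrancl_induct)
    case base
    then show ?case using assms(2) by simp
  next
    case (step x z)
    show ?case
    proof (cases "z \<in> A")
      case True
      then show ?thesis using step by (auto simp: adj_def)
    next
      case False
      then have "(x, z) \<in> adj ?T"
        using step by (auto simp: adj_def)
      then show ?thesis
        using step.IH[OF False] by (meson converse_rtrancl_into_rtrancl)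
    qed
  qed
  then obtain y y' where y: "y \<notin> A" "y' \<in> A" "{y, y'} \<in> T" "(x, y) \<in> (adj ?T)\<^sup>*"
    by blast
  moreover have "?T \<subseteq> T - {{y, y'}}"
    using y(2) by auto
  ultimately show thesis
    by (intro that[OF y(1-3)] rtrancl_adj_mono[OF _ y(4)])
qed

lemma rtrancl_adj_contract:
  assumes y: "y' \<in> A" "(x, y) \<in> (adj (T - {{y, y'}}))\<^sup>*"
    and "(z, b) \<in> (adj T)\<^sup>*" "b \<in> A"
  shows "\<exists>a\<in>insert x A. (z, a) \<in> (adj (T - {{y, y'}}))\<^sup>*"
  using assms(3,4)
proof (induction rule: converse_rtrancl_induct)
  case base
  then show ?case by auto
next
  case (step z z')
  show ?case
  proof (cases "{z, z'} = {y, y'}")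
    case True
    then have "z = y \<or> z = y'" by (auto simp: doubleton_eq_iff)
    then show ?thesis
      using y(1) rtrancl_adj_sym[OF y(2)] by auto
  next
    case False
    then have "(z, z') \<in> adj (T - {{y, y'}})" using step by (auto simp: adj_def)
    then show ?thesis
      using step by (meson converse_rtrancl_into_rtrancl)
  qed
qed

text \<open>
  \<open>A\<close> is thought of as contracted to a point: removing from \<open>T\<close> the edge through which the next
  vertex reaches \<open>A\<close> keeps everything connected to \<open>A\<close> extended by that vertex.
\<close>

lemma greedy_sum_le_connecting_weight:
  fixes h :: "'i :: linorder \<Rightarrow> 'a" and f :: "'i \<Rightarrow> 'b :: ordered_comm_monoid_add"
  assumes "finite S" "finite T" "\<And>e. e \<in> T \<Longrightarrow> 0 \<le> c e"
    and "inj_on h S" "h ` S \<inter> A = {}" "\<And>e. e \<in> T \<Longrightarrow> e \<subseteq> A \<union> h ` S"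
    and "\<And>s. s \<in> S \<Longrightarrow> \<exists>a\<in>A. (h s, a) \<in> (adj T)\<^sup>*"
    and "\<And>s t y. s \<in> S \<Longrightarrow> t \<in> S \<Longrightarrow> s \<le> t \<Longrightarrow> y \<in> A \<union> h ` {r \<in> S. r < s} \<Longrightarrow> {h t, y} \<in> T \<Longrightarrow>
      f s \<le> c {h t, y}"
  shows "(\<Sum>s\<in>S. f s) \<le> (\<Sum>e\<in>T. c e)"
  using assms
proof (induction S arbitrary: A T rule: finite_linorder_min_induct)
  case empty
  then show ?case by (simp add: sum_nonneg)
next
  case (insert s S)
  note finT = insert.prems(1) and nonneg = insert.prems(2) and inj = insert.prems(3)
    and disj = insert.prems(4) and edges = insert.prems(5) and connected = insert.prems(6)
    and greedy = insert.prems(7)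
  obtain a where "(h s, a) \<in> (adj T)\<^sup>*" "a \<in> A"
    using connected[of s] by auto
  then obtain y y' where y: "y \<notin> A" "y' \<in> A" "{y, y'} \<in> T" "(h s, y) \<in> (adj (T - {{y, y'}}))\<^sup>*"
    using disj by (auto elim: rtrancl_adj_first_entry)
  let ?T = "T - {{y, y'}}"
  have s: "s \<notin> S"
    using insert.hyps(2) by blast
  have "f s \<le> c {y, y'}"
  proof -
    obtain t where "t \<in> insert s S" "y = h t"
      using edges[OF y(3)] y(1) by auto
    then show ?thesis
      using greedy[of s t y'] insert.hyps(2) y by (auto intro: less_imp_le)
  qed
  moreover have "(\<Sum>t\<in>S. f t) \<le> (\<Sum>e\<in>?T. c e)"
  proof (rule insert.IH[of ?T "insert (h s) A"])
    show "\<exists>a\<in>insert (h s) A. (h t, a) \<in> (adj ?T)\<^sup>*" if "t \<in> S" for t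
      using connected[of t] rtrancl_adj_contract[OF y(2,4)] that by blast
    show "f r \<le> c {h t, z}"
      if "r \<in> S" "t \<in> S" "r \<le> t" "z \<in> insert (h s) A \<union> h ` {q \<in> S. q < r}" "{h t, z} \<in> ?T" for r t z
      using greedy[of r t z] that insert.hyps(2) by auto
  qed (use finT nonneg inj disj edges s in auto)
  moreover have "(\<Sum>e\<in>T. c e) = c {y, y'} + (\<Sum>e\<in>?T. c e)"
    using finT y(3) by (simp add: sum.remove)
  ultimately show ?case
    using insert.hyps(1) s by (simp add: add_mono)
qed

definition edge_weight :: "('a \<Rightarrow> 'a \<Rightarrow> real) \<Rightarrow> 'a set \<Rightarrow> real" where
  "edge_weight c e = (THE r. \<exists>x y. e = {x, y} \<and> r = c x y)"

lemma edges_weight_eq_sum: "edges_weight c T = (\<Sum>e\<in>T. edge_weight c e)"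
  by (simp add: edges_weight_def edge_weight_def)

lemma edge_weight_doubleton: "c x y = c y x \<Longrightarrow> edge_weight c {x, y} = c x y"
  unfolding edge_weight_def by (rule the_equality) (auto simp: doubleton_eq_iff)

section \<open>Prim's algorithm on the auxiliary graph\<close>

locale vrp_instance =
  fixes I :: "'v mcvrp"
  assumes mcvrp_instance: "mcvrp_instance I"
    and demand_le_capacity: "v \<in> customers I \<Longrightarrow> demand I v \<le> capacity I"
begin

abbreviation "V \<equiv> customers I"
abbreviation "d \<equiv> demand I"
abbreviation "k \<equiv> capacity I"
abbreviation "w \<equiv> weight I"
abbreviation "c0 \<equiv> depot_dist I"

lemma finite_customers: "finite V"
  and finite_depots: "finite (depots I)"
  and depots_nonempty: "depots I \<noteq> {}"
  and customers_not_depots: "V \<inter> depots I = {}"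
  and weight_sym: "x \<in> vertices I \<Longrightarrow> y \<in> vertices I \<Longrightarrow> w x y = w y x"
  and weight_nonneg: "x \<in> vertices I \<Longrightarrow> y \<in> vertices I \<Longrightarrow> 0 \<le> w x y"
  and demand_pos: "v \<in> V \<Longrightarrow> 0 < d v"
  using mcvrp_instance by (auto simp: mcvrp_instance_def Suc_le_eq)

lemma depot_dist_nonneg: "v \<in> V \<Longrightarrow> 0 \<le> c0 v"
  using finite_depots depots_nonempty weight_nonneg by (simp add: depot_dist_def)

lemma small_customers_iff: "v \<in> small_customers I \<longleftrightarrow> v \<in> V \<and> 2 * d v \<le> k"
  by (auto simp: small_customers_def)

fun linkable :: "'v option \<Rightarrow> 'v \<Rightarrow> bool" where
  "linkable None v \<longleftrightarrow> True"
| "linkable (Some u) v \<longleftrightarrow> u \<in> small_customers I \<and> v \<in> small_customers I"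

fun link_weight :: "'v option \<Rightarrow> 'v \<Rightarrow> real" where
  "link_weight None v = c0 v"
| "link_weight (Some u) v = w u v"

definition reached :: "'v list \<Rightarrow> 'v option set" where
  "reached xs = insert None (Some ` set xs)"

definition le_links :: "'v list \<Rightarrow> real \<Rightarrow> 'v \<Rightarrow> bool" where
  "le_links xs r v \<longleftrightarrow> (\<forall>a\<in>reached xs. linkable a v \<longrightarrow> r \<le> link_weight a v)"

definition prim_inv :: "'v list \<Rightarrow> ('v \<Rightarrow> 'v option) \<Rightarrow> ('v \<Rightarrow> real) \<Rightarrow> bool" where
  "prim_inv xs par key \<longleftrightarrow>
     distinct xs \<and> set xs \<subseteq> V \<and>
     (\<forall>v\<in>V. par v \<in> reached xs \<and> linkable (par v) v \<and> key v = link_weight (par v) v) \<and>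
     (\<forall>v\<in>V - set xs. le_links xs (key v) v) \<and>
     (\<forall>s<length xs. par (xs ! s) \<in> reached (take s xs)) \<and>
     (\<forall>s<length xs. \<forall>v\<in>V - set (take s xs). le_links (take s xs) (key (xs ! s)) v)"

definition relaxes :: "'v list \<Rightarrow> 'v \<Rightarrow> ('v \<Rightarrow> real) \<Rightarrow> 'v \<Rightarrow> bool" where
  "relaxes xs b key v \<longleftrightarrow> v \<notin> set (xs @ [b]) \<and> linkable (Some b) v \<and> w b v < key v"

definition relax_parent :: "'v list \<Rightarrow> 'v \<Rightarrow> ('v \<Rightarrow> real) \<Rightarrow> ('v \<Rightarrow> 'v option) \<Rightarrow> 'v \<Rightarrow> 'v option" where
  "relax_parent xs b key par v = (if relaxes xs b key v then Some b else par v)"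

definition relax_key :: "'v list \<Rightarrow> 'v \<Rightarrow> ('v \<Rightarrow> real) \<Rightarrow> 'v \<Rightarrow> real" where
  "relax_key xs b key v = (if relaxes xs b key v then w b v else key v)"

lemma reached_snoc [simp]: "reached (xs @ [b]) = insert (Some b) (reached xs)"
  by (auto simp: reached_def)

lemma prim_inv_Nil: "prim_inv [] (\<lambda>_. None) c0"
  by (simp add: prim_inv_def le_links_def reached_def)

lemma prim_inv_snoc:
  assumes inv: "prim_inv xs par key" and b: "b \<in> V - set xs" "\<forall>v\<in>V - set xs. key b \<le> key v"
  shows "prim_inv (xs @ [b]) (relax_parent xs b key par) (relax_key xs b key)"
    (is "prim_inv ?xs ?par ?key")
proof -
  have visited: "\<not> relaxes xs b key v" if "v \<in> set ?xs" for v
    using that by (simp add: relaxes_def)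
  have key_mono: "?key v \<le> key v" for v
    by (simp add: relax_key_def relaxes_def)
  have links: "\<forall>v\<in>V. ?par v \<in> reached ?xs \<and> linkable (?par v) v \<and> ?key v = link_weight (?par v) v"
    using inv by (auto simp: prim_inv_def relax_parent_def relax_key_def relaxes_def)
  have unvisited: "le_links ?xs (?key v) v" if "v \<in> V - set ?xs" for v
  proof -
    have "v \<in> V - set xs"
      using that by simp
    then have "le_links xs (key v) v"
      using inv unfolding prim_inv_def by blast
    moreover have "linkable (Some b) v \<longrightarrow> ?key v \<le> w b v"
      using that by (auto simp: relax_key_def relaxes_def)
    ultimately show ?thesis
      using key_mono[of v] by (auto simp: le_links_def intro: order_trans)
  qed
  have parents: "?par (?xs ! s) \<in> reached (take s ?xs)" if "s < length ?xs" for s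
    using that inv b(1) visited[of "?xs ! s"]
    by (auto simp: prim_inv_def relax_parent_def nth_append less_Suc_eq)
  have greedy: "le_links (take s ?xs) (?key (?xs ! s)) v"
    if "s < length ?xs" "v \<in> V - set (take s ?xs)" for s v
  proof (cases "s = length xs")
    case True
    then have "key b \<le> key v" "le_links xs (key v) v"
      using inv b(2) that(2) by (auto simp: prim_inv_def)
    then show ?thesis
      using True key_mono[of b] by (auto simp: le_links_def intro: order_trans)
  next
    case False
    then show ?thesis
      using that inv visited[of "?xs ! s"] by (auto simp: prim_inv_def relax_key_def nth_append)
  qed
  show ?thesis
    unfolding prim_inv_def using inv b(1) links unvisited parents greedy by (auto simp: prim_inv_def)
qed

lemma aux_weight_sym:
  "x \<in> aux_vertices I \<Longrightarrow> y \<in> aux_vertices I \<Longrightarrow> aux_weight I x y = aux_weight I y x"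
  using weight_sym by (auto simp: aux_vertices_def)

lemma aux_weight_nonneg: "x \<in> aux_vertices I \<Longrightarrow> y \<in> aux_vertices I \<Longrightarrow> 0 \<le> aux_weight I x y"
  using weight_nonneg depot_dist_nonneg by (auto simp: aux_vertices_def)

lemma small_spanning_tree_edge:
  assumes "small_min_spanning_tree I T" "e \<in> T"
  obtains x y where "e = {x, y}" "e \<subseteq> insert None (Some ` small_customers I)"
    and "edge_weight (aux_weight I) e = aux_weight I x y" "0 \<le> aux_weight I x y"
proof -
  have "e \<in> induced_edges (aux_edges I) (insert None (Some ` small_customers I))"
    using assms
    by (auto simp: small_min_spanning_tree_def Let_def min_spanning_tree_def spanning_tree_def)
  then obtain x y where "e = {x, y}" "x \<in> aux_vertices I" "y \<in> aux_vertices I"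
      "e \<subseteq> insert None (Some ` small_customers I)"
    unfolding induced_edges_def aux_edges_def by blast
  then show thesis
    using that aux_weight_sym aux_weight_nonneg edge_weight_doubleton by metis
qed

text \<open>
  Links have weight \<open>w\<close>, not \<open>c\<close>: an edge of \<open>c\<close>-weight \<open>c(o,u) + c(o,v)\<close> is dominated by the depot
  edge of \<open>v\<close>, which is always available.
\<close>

lemma le_links_imp_le_aux_weight:
  assumes "le_links xs r v" "v \<in> small_customers I"
    and a: "a \<in> insert None (Some ` (set xs \<inter> small_customers I))"
  shows "r \<le> aux_weight I (Some v) a"
proof (cases a)
  case None
  then show ?thesis using assms(1) by (simp add: le_links_def reached_def)
next
  case (Some u)
  then have u: "u \<in> set xs" "u \<in> small_customers I"
    using a by auto
  then have "r \<le> c0 v" "r \<le> w u v"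
    using assms(1,2) by (auto simp: le_links_def reached_def)
  moreover have "0 \<le> c0 u" "w u v = w v u"
    using u(2) assms(2) depot_dist_nonneg weight_sym by (auto simp: small_customers_iff)
  ultimately show ?thesis using Some by simp
qed

lemma prim_key_le_tree_edge:
  assumes inv: "prim_inv xs par key" and T: "small_min_spanning_tree I T"
    and s: "s < length xs" and t: "s \<le> t" "t < length xs" "xs ! t \<in> small_customers I"
    and y: "y \<in> insert None ((\<lambda>r. Some (xs ! r)) ` {r. r < s \<and> xs ! r \<in> small_customers I})"
    and e: "{Some (xs ! t), y} \<in> T"
  shows "key (xs ! s) \<le> edge_weight (aux_weight I) {Some (xs ! t), y}"
proof -
  have "xs ! t \<notin> set (take s xs)"
    using inv t by (auto simp: prim_inv_def in_set_conv_nth nth_eq_iff_index_eq)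
  then have "le_links (take s xs) (key (xs ! s)) (xs ! t)"
    using inv s t(3) by (simp add: prim_inv_def small_customers_iff)
  moreover have "xs ! r \<in> set (take s xs)" if "r < s" for r
    using that s nth_mem[of r "take s xs"] by simp
  then have "y \<in> insert None (Some ` (set (take s xs) \<inter> small_customers I))"
    using y by auto
  ultimately have "key (xs ! s) \<le> aux_weight I (Some (xs ! t)) y"
    using le_links_imp_le_aux_weight t(3) by blast
  moreover have "Some (xs ! t) \<in> aux_vertices I" "y \<in> aux_vertices I"
    using t(3) y by (auto simp: aux_vertices_def small_customers_iff)
  ultimately show ?thesis
    by (simp add: edge_weight_doubleton aux_weight_sym)
qed

lemma sum_key_le_spanning_tree_weight:
  assumes inv: "prim_inv xs par key" and all: "set xs = V" and T: "small_min_spanning_tree I T"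
  shows "(\<Sum>v\<in>small_customers I. key v) \<le> edges_weight (aux_weight I) T"
proof -
  let ?J = "{s. s < length xs \<and> xs ! s \<in> small_customers I}"
  let ?h = "\<lambda>s. Some (xs ! s)"
  have "(!) xs ` ?J = set xs \<inter> small_customers I"
    by (auto simp: set_conv_nth)
  then have small: "(!) xs ` ?J = small_customers I"
    using all by (auto simp: small_customers_def)
  then have h: "{None} \<union> ?h ` ?J = insert None (Some ` small_customers I)"
    using image_image[of Some "(!) xs" ?J] by simp
  have inj: "inj_on ((!) xs) ?J"
    using inv by (auto simp: prim_inv_def inj_on_def nth_eq_iff_index_eq)
  have edge: "e \<subseteq> {None} \<union> ?h ` ?J" "0 \<le> edge_weight (aux_weight I) e" if "e \<in> T" for e
    using small_spanning_tree_edge[OF T that] unfolding h by metis+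
  have "finite (insert None (Some ` small_customers I))"
    using finite_customers by (simp add: small_customers_def)
  then have "finite T"
    using edge(1) finite_subset[of T "Pow ({None} \<union> ?h ` ?J)"] unfolding h by auto
  have "graph_connected (insert None (Some ` small_customers I)) T"
    using T by (simp add: small_min_spanning_tree_def Let_def min_spanning_tree_def spanning_tree_def)
  then have connected: "(?h s, None) \<in> (adj T)\<^sup>*" if "s \<in> ?J" for s
    using that by (simp add: graph_connected_def adj_def)
  have "(\<Sum>s\<in>?J. key (xs ! s)) \<le> (\<Sum>e\<in>T. edge_weight (aux_weight I) e)"
  proof (rule greedy_sum_le_connecting_weight[where h = ?h and A = "{None}"])
    show "key (xs ! s) \<le> edge_weight (aux_weight I) {?h t, y}"
      if "s \<in> ?J" "t \<in> ?J" "s \<le> t" "y \<in> {None} \<union> ?h ` {r \<in> ?J. r < s}" "{?h t, y} \<in> T" for s t y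
      by (rule prim_key_le_tree_edge[OF inv T]) (use that in auto)
  qed (use \<open>finite T\<close> edge connected inj in \<open>auto simp: inj_on_def\<close>)
  moreover have "(\<Sum>s\<in>?J. key (xs ! s)) = (\<Sum>v\<in>small_customers I. key v)"
    using sum.reindex[OF inj, of key] small by simp
  ultimately show ?thesis
    by (simp add: edges_weight_eq_sum)
qed

lemma prim_inv_complete:
  assumes "prim_inv xs par key" "length xs = card V"
  shows "set xs = V"
  using assms finite_customers distinct_card[of xs]
  by (intro card_subset_eq) (auto simp: prim_inv_def)

end

section \<open>Closed walks\<close>

lemma walk_cost_singleton [simp]: "walk_cost I [x] = 0"
  by (simp add: walk_cost_def)

lemma walk_cost_Cons_Cons [simp]: "walk_cost I (x # y # zs) = weight I x y + walk_cost I (y # zs)"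
  unfolding walk_cost_def by (simp add: sum.lessThan_Suc_shift del: sum.lessThan_Suc)

lemma walk_cost_append:
  "xs \<noteq> [] \<Longrightarrow> ys \<noteq> [] \<Longrightarrow>
    walk_cost I (xs @ ys) = walk_cost I xs + weight I (last xs) (hd ys) + walk_cost I ys"
proof (induction xs rule: induct_list012)
  case (2 x)
  then show ?case by (cases ys) auto
qed auto

definition walk_join :: "'a list \<Rightarrow> 'a list \<Rightarrow> 'a list" where
  "walk_join xs ys = xs @ tl ys"

lemma
  assumes "xs \<noteq> []" "ys \<noteq> []" "last xs = hd ys"
  shows set_walk_join: "set (walk_join xs ys) = set xs \<union> set ys"
    and hd_walk_join: "hd (walk_join xs ys) = hd xs"
    and last_walk_join: "last (walk_join xs ys) = last ys"
    and successively_walk_join: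
      "successively R (walk_join xs ys) \<longleftrightarrow> successively R xs \<and> successively R ys"
    and walk_cost_walk_join: "walk_cost I (walk_join xs ys) = walk_cost I xs + walk_cost I ys"
proof -
  obtain y zs where ys: "ys = y # zs" "last xs = y"
    using assms(2,3) by (cases ys) auto
  have "y \<in> set xs"
    using ys(2) assms(1) by auto
  then show "set (walk_join xs ys) = set xs \<union> set ys"
    using ys by (auto simp: walk_join_def)
  show "hd (walk_join xs ys) = hd xs" "last (walk_join xs ys) = last ys"
    using ys assms(1) by (simp_all add: walk_join_def)
  show "successively R (walk_join xs ys) \<longleftrightarrow> successively R xs \<and> successively R ys"
    using ys assms(1) by (cases zs) (auto simp: walk_join_def successively_append_iff)
  show "walk_cost I (walk_join xs ys) = walk_cost I xs + walk_cost I ys"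
    using ys assms(1) by (cases zs) (auto simp: walk_join_def walk_cost_append)
qed

definition rotate_closed :: "nat \<Rightarrow> 'a list \<Rightarrow> 'a list" where
  "rotate_closed x l = walk_join (drop x l) (take (Suc x) l)"

lemma walk_join_take_drop: "x < length l \<Longrightarrow> walk_join (take (Suc x) l) (drop x l) = l"
  by (simp add: walk_join_def tl_drop flip: drop_Suc)

lemma length_rotate_closed: "x < length l \<Longrightarrow> length (rotate_closed x l) = length l"
  by (simp add: rotate_closed_def walk_join_def)

lemma nth_rotate_closed:
  assumes "x < length l" "q < length l"
  shows "rotate_closed x l ! q =
    (if q < length l - x then l ! (x + q) else l ! Suc (q - (length l - x)))"
  using assms by (auto simp: rotate_closed_def walk_join_def nth_append nth_tl)

lemma
  assumes x: "x < length l" and closed: "last l = hd l"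
  shows set_rotate_closed: "set (rotate_closed x l) = set l"
    and hd_rotate_closed: "hd (rotate_closed x l) = l ! x"
    and last_rotate_closed: "last (rotate_closed x l) = l ! x"
    and successively_rotate_closed: "successively R (rotate_closed x l) \<longleftrightarrow> successively R l"
    and walk_cost_rotate_closed: "walk_cost I (rotate_closed x l) = walk_cost I l"
proof -
  let ?a = "take (Suc x) l" and ?b = "drop x l"
  have nonempty: "?a \<noteq> []" "?b \<noteq> []"
    using x by auto
  have ends: "last ?a = l ! x" "hd ?b = l ! x" "last ?b = last l"
    using x by (simp_all add: hd_drop_conv_nth take_Suc_conv_app_nth)
  have "hd ?a = hd l"
    using x by (cases l) simp_all
  note join = nonempty(1,2) trans[OF ends(1) ends(2)[symmetric]]
  note rotated = nonempty(2,1) trans[OF ends(3) trans[OF closed \<open>hd ?a = hd l\<close>[symmetric]]]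
  note l = walk_join_take_drop[OF x]
  show "set (rotate_closed x l) = set l"
    using set_walk_join[OF join] set_walk_join[OF rotated] l by (simp add: rotate_closed_def Un_commute)
  show "hd (rotate_closed x l) = l ! x" "last (rotate_closed x l) = l ! x"
    using hd_walk_join[OF rotated] last_walk_join[OF rotated] ends by (simp_all add: rotate_closed_def)
  show "successively R (rotate_closed x l) \<longleftrightarrow> successively R l"
    using successively_walk_join[OF join] successively_walk_join[OF rotated] l
    by (auto simp: rotate_closed_def)
  show "walk_cost I (rotate_closed x l) = walk_cost I l"
    using walk_cost_walk_join[OF join] walk_cost_walk_join[OF rotated] l
    by (simp add: rotate_closed_def)
qed

section \<open>Bags\<close>

definition demand_bag :: "('v \<Rightarrow> nat) \<Rightarrow> 'v \<Rightarrow> 'v tour" where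
  "demand_bag d v = \<lparr>walk = [v], deliver = (\<lambda>_. 0)(v := d v)\<rparr>"

definition empty_bag :: "'v \<Rightarrow> 'v tour" where
  "empty_bag v = \<lparr>walk = [v], deliver = (\<lambda>_. 0)\<rparr>"

definition merge_bags :: "'v tour \<Rightarrow> 'v tour \<Rightarrow> 'v tour" where
  "merge_bags \<beta> \<gamma> =
    \<lparr>walk = walk \<beta> @ walk \<gamma> @ [hd (walk \<beta>)], deliver = (\<lambda>x. deliver \<beta> x + deliver \<gamma> x)\<rparr>"

definition depot_tour :: "'v \<Rightarrow> nat \<Rightarrow> 'v tour \<Rightarrow> 'v tour" where
  "depot_tour u x \<beta> = \<lparr>walk = u # rotate_closed x (walk \<beta>) @ [u], deliver = deliver \<beta>\<rparr>"

lemma bag_sel [simp]: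
  "walk (demand_bag d v) = [v]" "deliver (demand_bag d v) = (\<lambda>_. 0)(v := d v)"
  "walk (empty_bag v) = [v]" "deliver (empty_bag v) = (\<lambda>_. 0)"
  "deliver (merge_bags \<beta> \<gamma>) = (\<lambda>x. deliver \<beta> x + deliver \<gamma> x)"
  "deliver (depot_tour u x \<beta>) = deliver \<beta>"
  by (simp_all add: demand_bag_def empty_bag_def merge_bags_def depot_tour_def)

context vrp_instance
begin

definition unsplit :: "'v tour \<Rightarrow> bool" where
  "unsplit \<beta> \<longleftrightarrow> (\<forall>v\<in>V. deliver \<beta> v = 0 \<or> deliver \<beta> v = d v)"

definition is_bag :: "'v \<Rightarrow> 'v tour \<Rightarrow> bool" where
  "is_bag v \<beta> \<longleftrightarrow> walk \<beta> \<noteq> [] \<and> hd (walk \<beta>) = v \<and> last (walk \<beta>) = v \<and> set (walk \<beta>) \<subseteq> V \<and>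
     successively (\<noteq>) (walk \<beta>) \<and> (\<forall>x. deliver \<beta> x \<noteq> 0 \<longrightarrow> x \<in> set (walk \<beta>)) \<and> unsplit \<beta>"

definition load :: "'v tour \<Rightarrow> nat" where
  "load \<beta> = (\<Sum>v\<in>V. deliver \<beta> v)"

definition delivery_dist :: "'v tour \<Rightarrow> real" where
  "delivery_dist \<beta> = (\<Sum>v\<in>V. real (deliver \<beta> v) * c0 v)"

definition cheapest_detour :: "'v list \<Rightarrow> nat \<Rightarrow> 'v \<Rightarrow> bool" where
  "cheapest_detour l x u \<longleftrightarrow>
     is_arg_min (\<lambda>q. c0 (l ! q)) (\<lambda>q. q < length l) x \<and> u \<in> depots I \<and> w u (l ! x) = c0 (l ! x)"

definition detour_rate :: real where
  "detour_rate = 2 / (real (k div 2) + 1)"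

lemma load_bag [simp]:
  "load (empty_bag v) = 0"
  "load (merge_bags \<beta> \<gamma>) = load \<beta> + load \<gamma>"
  "v \<in> V \<Longrightarrow> load (demand_bag d v) = d v"
  using finite_customers by (simp_all add: load_def sum.distrib sum.delta' fun_upd_def)

lemma delivery_dist_depot_tour [simp]: "delivery_dist (depot_tour u x \<beta>) = delivery_dist \<beta>"
  by (simp add: delivery_dist_def)

lemma cheapest_detour_le: "cheapest_detour l x u \<Longrightarrow> v \<in> set l \<Longrightarrow> c0 (l ! x) \<le> c0 v"
  by (auto simp: cheapest_detour_def is_arg_min_linorder in_set_conv_nth)

lemma detour_price_nonneg: "0 \<le> detour_rate * delivery_dist \<beta>"
  unfolding detour_rate_def delivery_dist_def using depot_dist_nonneg
  by (intro mult_nonneg_nonneg sum_nonneg) auto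

lemma is_bag_demand_bag: "v \<in> V \<Longrightarrow> is_bag v (demand_bag d v)"
  and is_bag_empty_bag: "v \<in> V \<Longrightarrow> is_bag v (empty_bag v)"
  by (simp_all add: is_bag_def unsplit_def)

lemma is_bag_merge_bags:
  assumes "is_bag r \<beta>" "is_bag v \<gamma>" "r \<noteq> v"
    and "\<And>x. x \<in> V \<Longrightarrow> deliver \<beta> x + deliver \<gamma> x \<le> d x"
  shows "is_bag r (merge_bags \<beta> \<gamma>)"
proof -
  have "unsplit (merge_bags \<beta> \<gamma>)"
    unfolding unsplit_def
  proof
    fix x
    assume x: "x \<in> V"
    then have "deliver \<beta> x = 0 \<or> deliver \<beta> x = d x" "deliver \<gamma> x = 0 \<or> deliver \<gamma> x = d x"
      using assms(1,2) by (auto simp: is_bag_def unsplit_def)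
    then show "deliver (merge_bags \<beta> \<gamma>) x = 0 \<or> deliver (merge_bags \<beta> \<gamma>) x = d x"
      using assms(4)[OF x] by auto
  qed
  then show ?thesis
    using assms(1-3)
    by (auto simp: is_bag_def merge_bags_def successively_append_iff hd_append)
qed

lemma walk_cost_merge_bags:
  assumes "is_bag r \<beta>" "is_bag v \<gamma>"
  shows "walk_cost I (walk (merge_bags \<beta> \<gamma>)) = walk_cost I (walk \<beta>) + walk_cost I (walk \<gamma>) + 2 * w r v"
proof -
  have "r \<in> V" "v \<in> V"
    using assms by (auto simp: is_bag_def)
  then have "w v r = w r v"
    using weight_sym by simp
  then show ?thesis
    using assms walk_cost_append[of "walk \<beta>" "walk \<gamma> @ [r]"] walk_cost_append[of "walk \<gamma>" "[r]"]
    by (simp add: is_bag_def merge_bags_def)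
qed

lemma is_tour_depot_tour:
  assumes bag: "is_bag v \<beta>" and detour: "cheapest_detour (walk \<beta>) x u" and "load \<beta> \<le> k"
  shows "is_tour I (depot_tour u x \<beta>)"
proof -
  have x: "x < length (walk \<beta>)" and u: "u \<in> depots I"
    using detour by (simp_all add: cheapest_detour_def is_arg_min_def)
  have closed: "last (walk \<beta>) = hd (walk \<beta>)"
    using bag by (simp add: is_bag_def)
  have nonempty: "rotate_closed x (walk \<beta>) \<noteq> []"
    using length_rotate_closed[OF x] x by auto
  have "u \<notin> V"
    using u customers_not_depots by blast
  moreover have "walk \<beta> ! x \<in> V"
    using bag x nth_mem by (auto simp: is_bag_def)
  ultimately have "successively (\<noteq>) (walk (depot_tour u x \<beta>))"
    using bag nonempty hd_rotate_closed[OF x closed] last_rotate_closed[OF x closed]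
      successively_rotate_closed[OF x closed, of "(\<noteq>)"]
    by (auto simp: depot_tour_def is_bag_def successively_append_iff successively_Cons)
  then show ?thesis
    using assms u set_rotate_closed[OF x closed]
    by (auto simp: is_tour_def depot_tour_def is_bag_def load_def)
qed

lemma walk_cost_depot_tour:
  assumes bag: "is_bag v \<beta>" and detour: "cheapest_detour (walk \<beta>) x u"
  shows "walk_cost I (walk (depot_tour u x \<beta>)) = walk_cost I (walk \<beta>) + 2 * c0 (walk \<beta> ! x)"
proof -
  have x: "x < length (walk \<beta>)" and u: "u \<in> depots I" "w u (walk \<beta> ! x) = c0 (walk \<beta> ! x)"
    using detour by (simp_all add: cheapest_detour_def is_arg_min_def)
  have closed: "last (walk \<beta>) = hd (walk \<beta>)"
    using bag by (simp add: is_bag_def)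
  have nonempty: "rotate_closed x (walk \<beta>) \<noteq> []"
    using length_rotate_closed[OF x] x by auto
  have "walk \<beta> ! x \<in> V"
    using bag x nth_mem by (auto simp: is_bag_def)
  then have "w (walk \<beta> ! x) u = c0 (walk \<beta> ! x)"
    using u weight_sym by simp
  then show ?thesis
    using walk_cost_append[of "[u]" "rotate_closed x (walk \<beta>) @ [u]" I]
      walk_cost_append[of "rotate_closed x (walk \<beta>)" "[u]" I] nonempty u(2)
      hd_rotate_closed[OF x closed] last_rotate_closed[OF x closed] walk_cost_rotate_closed[OF x closed]
    by (simp add: depot_tour_def)
qed

lemma detour_le_delivery_dist:
  assumes bag: "is_bag v \<beta>" and heavy: "k < 2 * load \<beta>"
    and detour: "cheapest_detour (walk \<beta>) x u"
  shows "2 * c0 (walk \<beta> ! x) \<le> detour_rate * delivery_dist \<beta>"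
proof -
  let ?c = "c0 (walk \<beta> ! x)"
  have "walk \<beta> ! x \<in> V"
    using bag detour nth_mem[of x "walk \<beta>"]
    by (auto simp: is_bag_def cheapest_detour_def is_arg_min_def)
  then have "0 \<le> ?c"
    by (rule depot_dist_nonneg)
  moreover have "k div 2 + 1 \<le> load \<beta>"
    using heavy by simp
  then have "real (k div 2) + 1 \<le> real (load \<beta>)"
    by (metis of_nat_1 of_nat_add of_nat_le_iff)
  ultimately have "(real (k div 2) + 1) * ?c \<le> real (load \<beta>) * ?c"
    by (intro mult_right_mono)
  also have "\<dots> = (\<Sum>v\<in>V. real (deliver \<beta> v) * ?c)"
    by (simp add: load_def sum_distrib_right)
  also have "\<dots> \<le> delivery_dist \<beta>"
    unfolding delivery_dist_def
  proof (rule sum_mono)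
    fix v
    assume "v \<in> V"
    show "real (deliver \<beta> v) * ?c \<le> real (deliver \<beta> v) * c0 v"
      using bag cheapest_detour_le[OF detour, of v]
      by (cases "deliver \<beta> v = 0") (auto simp: is_bag_def intro: mult_left_mono)
  qed
  finally show ?thesis
    by (simp add: detour_rate_def field_simps)
qed

end

section \<open>Partial solutions\<close>

lemma sum_fun_upd:
  fixes g :: "'b \<Rightarrow> 'c :: comm_monoid_add"
  assumes "finite U" "r \<in> U"
  shows "(\<Sum>u\<in>U. g ((B(r := b)) u)) + g (B r) = g b + (\<Sum>u\<in>U. g (B u))"
  using sum.remove[OF assms, of "\<lambda>u. g (B u)"] sum.remove[OF assms, of "\<lambda>u. g ((B(r := b)) u)"]
  by (simp add: ac_simps)

lemma sum_fun_upd_remove: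
  fixes g :: "'b \<Rightarrow> 'c :: comm_monoid_add"
  assumes "finite U" "v \<in> U" "r \<in> U" "r \<noteq> v"
  shows "(\<Sum>u\<in>U - {v}. g ((B(r := b)) u)) + (g (B r) + g (B v)) = g b + (\<Sum>u\<in>U. g (B u))"
proof -
  let ?S = "\<Sum>u\<in>U - {v}. g ((B(r := b)) u)"
  have "?S + (g (B r) + g (B v)) = (?S + g (B r)) + g (B v)"
    by (simp add: add.assoc)
  also have "?S + g (B r) = g b + (\<Sum>u\<in>U - {v}. g (B u))"
    using assms by (intro sum_fun_upd) auto
  finally show ?thesis
    using sum.remove[OF assms(1,2), of "\<lambda>u. g (B u)"] by (simp add: ac_simps)
qed

context vrp_instance
begin

text \<open>
  \<open>U\<close> is the set of customers whose bag is still open and \<open>ts\<close> the list of finished tours. The last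
  conjunct bounds the length of the walks that a program has to copy.
\<close>

definition partial_solution ::
    "('v \<Rightarrow> real) \<Rightarrow> 'v set \<Rightarrow> ('v \<Rightarrow> 'v tour) \<Rightarrow> 'v tour list \<Rightarrow> bool" where
  "partial_solution key U B ts \<longleftrightarrow>
     U \<subseteq> V \<and> (\<forall>u\<in>U. is_bag u (B u)) \<and> (\<forall>\<tau>\<in>set ts. is_tour I \<tau> \<and> unsplit \<tau>) \<and>
     (\<forall>v\<in>V. (\<Sum>u\<in>U. deliver (B u) v) + (\<Sum>\<tau>\<leftarrow>ts. deliver \<tau> v) = d v) \<and>
     (\<Sum>u\<in>U. walk_cost I (walk (B u))) + solution_cost I ts
       \<le> 2 * (\<Sum>v\<in>small_customers I - U. key v) + detour_rate * (\<Sum>\<tau>\<leftarrow>ts. delivery_dist \<tau>) \<and>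
     (\<Sum>u\<in>U. length (walk (B u))) + card U \<le> 2 * card V"

lemma solution_cost_snoc: "solution_cost I (ts @ [\<tau>]) = solution_cost I ts + walk_cost I (walk \<tau>)"
  by (simp add: solution_cost_def)

lemma sum_key_insert:
  assumes "U \<subseteq> V" "v \<in> U" "v \<in> small_customers I"
  shows "(\<Sum>x\<in>small_customers I - (U - {v}). key x) = key v + (\<Sum>x\<in>small_customers I - U. key x :: real)"
proof -
  have "small_customers I - (U - {v}) = insert v (small_customers I - U)"
    using assms by auto
  moreover have "finite (small_customers I - U)"
    using finite_customers by (simp add: small_customers_def)
  ultimately show ?thesis
    using assms(2) by simp
qed

lemma partial_solution_initial: "partial_solution key V (demand_bag d) []"
proof -
  have "(\<Sum>u\<in>V. ((\<lambda>_. 0)(u := d u)) v) = d v" if "v \<in> V" for v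
    using that finite_customers by (simp add: fun_upd_def sum.delta')
  moreover have "(\<Sum>v\<in>small_customers I - V. key v) = 0"
    by (rule sum.neutral) (auto simp: small_customers_def)
  ultimately show ?thesis
    by (simp add: partial_solution_def is_bag_demand_bag solution_cost_def)
qed

lemma partial_solution_cong:
  assumes "\<And>u. u \<in> U \<Longrightarrow> B u = B' u"
  shows "partial_solution key U B ts \<longleftrightarrow> partial_solution key U B' ts"
  unfolding partial_solution_def using assms by (simp cong: sum.cong)

lemma partial_solution_merge:
  assumes ps: "partial_solution key U B ts" and U: "v \<in> U" "r \<in> U" "r \<noteq> v"
    and v: "v \<in> small_customers I" "key v = w r v"
  shows "partial_solution key (U - {v}) (B(r := merge_bags (B r) (B v))) ts"
    (is "partial_solution key ?U ?B ts")
proof -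
  have "U \<subseteq> V" and fin: "finite U"
    using ps finite_customers finite_subset by (auto simp: partial_solution_def)
  have bags: "is_bag r (B r)" "is_bag v (B v)"
    using ps U by (auto simp: partial_solution_def)
  note sum = sum_fun_upd_remove[OF fin U, where B = B and b = "merge_bags (B r) (B v)"]
  have "(\<Sum>u\<in>?U. deliver (?B u) x) = (\<Sum>u\<in>U. deliver (B u) x)" for x
    using sum[of "\<lambda>\<beta>. deliver \<beta> x"] by simp
  then have conserved: "\<forall>x\<in>V. (\<Sum>u\<in>?U. deliver (?B u) x) + (\<Sum>\<tau>\<leftarrow>ts. deliver \<tau> x) = d x"
    using ps unfolding partial_solution_def by metis
  have "deliver (B r) x + deliver (B v) x \<le> d x" if "x \<in> V" for x
  proof -
    have "(\<Sum>u\<in>{r, v}. deliver (B u) x) \<le> (\<Sum>u\<in>U. deliver (B u) x)"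
      using fin U by (intro sum_mono2) auto
    also have "\<dots> \<le> d x"
      using ps that unfolding partial_solution_def by (metis le_add1)
    finally show ?thesis
      using U(3) by simp
  qed
  then have merged: "is_bag r (merge_bags (B r) (B v))"
    by (rule is_bag_merge_bags[OF bags U(3)])
  have "(\<Sum>u\<in>?U. walk_cost I (walk (?B u))) = (\<Sum>u\<in>U. walk_cost I (walk (B u))) + 2 * key v"
    using sum[of "\<lambda>\<beta>. walk_cost I (walk \<beta>)"] walk_cost_merge_bags[OF bags] v(2) by simp
  moreover have "(\<Sum>u\<in>?U. length (walk (?B u))) = (\<Sum>u\<in>U. length (walk (B u))) + 1"
    using sum[of "\<lambda>\<beta>. length (walk \<beta>)"] by (simp add: merge_bags_def)
  moreover have "card U = card ?U + 1"
    using card.remove[OF fin U(1)] by simp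
  ultimately show ?thesis
    using ps merged conserved sum_key_insert[OF \<open>U \<subseteq> V\<close> U(1) v(1), of key]
    by (auto simp: partial_solution_def)
qed

lemma partial_solution_emit:
  assumes ps: "partial_solution key U B ts" and r: "r \<in> U"
    and load: "k < 2 * load (B r)" "load (B r) \<le> k"
    and detour: "cheapest_detour (walk (B r)) x u"
  shows "partial_solution key U (B(r := empty_bag r)) (ts @ [depot_tour u x (B r)])"
    (is "partial_solution key U ?B ?ts")
proof -
  have "U \<subseteq> V" and fin: "finite U"
    using ps finite_customers finite_subset by (auto simp: partial_solution_def)
  have bag: "is_bag r (B r)"
    using ps r by (auto simp: partial_solution_def)
  note sum = sum_fun_upd[OF fin r, where B = B and b = "empty_bag r"]
  have "(\<Sum>u\<in>U. deliver (?B u) v) + (\<Sum>\<tau>\<leftarrow>?ts. deliver \<tau> v) =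
      (\<Sum>u\<in>U. deliver (B u) v) + (\<Sum>\<tau>\<leftarrow>ts. deliver \<tau> v)" for v
    using sum[of "\<lambda>\<beta>. deliver \<beta> v"] by simp
  then have "\<forall>v\<in>V. (\<Sum>u\<in>U. deliver (?B u) v) + (\<Sum>\<tau>\<leftarrow>?ts. deliver \<tau> v) = d v"
    using ps unfolding partial_solution_def by metis
  moreover have "(\<Sum>u\<in>U. walk_cost I (walk (?B u))) + walk_cost I (walk (B r)) =
      (\<Sum>u\<in>U. walk_cost I (walk (B u)))"
    using sum[of "\<lambda>\<beta>. walk_cost I (walk \<beta>)"] by simp
  then have "(\<Sum>u\<in>U. walk_cost I (walk (?B u))) + solution_cost I ?ts
      \<le> 2 * (\<Sum>v\<in>small_customers I - U. key v) + detour_rate * (\<Sum>\<tau>\<leftarrow>?ts. delivery_dist \<tau>)"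
    using ps walk_cost_depot_tour[OF bag detour] detour_le_delivery_dist[OF bag load(1) detour]
    by (simp add: partial_solution_def solution_cost_snoc distrib_left)
  moreover have "1 \<le> length (walk (B r))"
    using bag by (simp add: is_bag_def Suc_le_eq)
  then have "(\<Sum>u\<in>U. length (walk (?B u))) \<le> (\<Sum>u\<in>U. length (walk (B u)))"
    using sum[of "\<lambda>\<beta>. length (walk \<beta>)"] by simp
  moreover have "is_tour I (depot_tour u x (B r))" "unsplit (depot_tour u x (B r))"
    using is_tour_depot_tour[OF bag detour load(2)] bag by (simp_all add: is_bag_def unsplit_def)
  ultimately show ?thesis
    using ps r \<open>U \<subseteq> V\<close> is_bag_empty_bag by (auto simp: partial_solution_def)
qed

lemma partial_solution_close_light:
  assumes ps: "partial_solution key U B ts" and v: "v \<in> U" "v \<in> small_customers I" "key v = c0 v"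
    and load: "load (B v) \<le> k"
    and detour: "cheapest_detour (walk (B v)) x u"
  shows "partial_solution key (U - {v}) B (ts @ [depot_tour u x (B v)])"
    (is "partial_solution key ?U B ?ts")
proof -
  have "U \<subseteq> V" and fin: "finite U"
    using ps finite_customers finite_subset by (auto simp: partial_solution_def)
  have bag: "is_bag v (B v)"
    using ps v(1) by (auto simp: partial_solution_def)
  have "v \<in> set (walk (B v))"
    using bag hd_in_set by (fastforce simp: is_bag_def)
  then have "c0 (walk (B v) ! x) \<le> key v"
    using cheapest_detour_le[OF detour] v(3) by simp
  then have "(\<Sum>u\<in>?U. walk_cost I (walk (B u))) + solution_cost I ?ts
      \<le> 2 * (\<Sum>v\<in>small_customers I - ?U. key v) + detour_rate * (\<Sum>\<tau>\<leftarrow>?ts. delivery_dist \<tau>)"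
    using ps sum.remove[OF fin v(1), of "\<lambda>u. walk_cost I (walk (B u))"]
      sum_key_insert[OF \<open>U \<subseteq> V\<close> v(1,2), of key] walk_cost_depot_tour[OF bag detour]
      detour_price_nonneg[of "B v"]
    by (simp add: partial_solution_def solution_cost_snoc distrib_left)
  moreover have "(\<Sum>u\<in>U. deliver (B u) y) = deliver (B v) y + (\<Sum>u\<in>?U. deliver (B u) y)" for y
    using sum.remove[OF fin v(1)] .
  moreover have "(\<Sum>u\<in>U. length (walk (B u))) = length (walk (B v)) + (\<Sum>u\<in>?U. length (walk (B u)))"
    using sum.remove[OF fin v(1)] .
  moreover have "card ?U \<le> card U"
    using fin by (intro card_mono) auto
  moreover have "is_tour I (depot_tour u x (B v))" "unsplit (depot_tour u x (B v))"
    using is_tour_depot_tour[OF bag detour load] bag by (simp_all add: is_bag_def unsplit_def)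
  ultimately show ?thesis
    using ps by (auto simp: partial_solution_def)
qed

lemma partial_solution_drop_empty:
  assumes ps: "partial_solution key U B ts" and v: "v \<in> U" "v \<notin> small_customers I" "B v = empty_bag v"
  shows "partial_solution key (U - {v}) B ts"
    (is "partial_solution key ?U B ts")
proof -
  have fin: "finite U"
    using ps finite_customers finite_subset by (auto simp: partial_solution_def)
  have "small_customers I - ?U = small_customers I - U"
    using v(2) by auto
  moreover have "card ?U \<le> card U"
    using fin by (intro card_mono) auto
  ultimately show ?thesis
    using ps v(3) sum.remove[OF fin v(1), of "\<lambda>u. deliver (B u) x" for x]
      sum.remove[OF fin v(1), of "\<lambda>u. walk_cost I (walk (B u))"]
      sum.remove[OF fin v(1), of "\<lambda>u. length (walk (B u))"]
    by (auto simp: partial_solution_def)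
qed

lemma partial_solution_final:
  assumes ps: "partial_solution key {} B ts"
  shows "feasible \<nu> I ts"
    and "solution_cost I ts \<le> detour_rate * Delta I + 2 * (\<Sum>v\<in>small_customers I. key v)"
proof -
  have served: "(\<Sum>\<tau>\<leftarrow>ts. deliver \<tau> v) = d v" if "v \<in> V" for v
    using ps that by (simp add: partial_solution_def)
  have "\<exists>\<tau>\<in>set ts. deliver \<tau> v = d v" if v: "v \<in> V" for v
  proof -
    have "(\<Sum>\<tau>\<leftarrow>ts. deliver \<tau> v) \<noteq> 0"
      using served[OF v] demand_pos[OF v] by simp
    then obtain \<tau> where "\<tau> \<in> set ts" "deliver \<tau> v \<noteq> 0"
      by auto
    moreover from this have "deliver \<tau> v = 0 \<or> deliver \<tau> v = d v"
      using ps v unfolding partial_solution_def unsplit_def by blast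
    ultimately show ?thesis
      by auto
  qed
  then show "feasible \<nu> I ts"
    using ps served by (simp add: partial_solution_def feasible_def)
  have "(\<Sum>\<tau>\<leftarrow>ts. delivery_dist \<tau>) = (\<Sum>v\<in>V. \<Sum>\<tau>\<leftarrow>ts. real (deliver \<tau> v) * c0 v)"
    unfolding delivery_dist_def by (induction ts) (simp_all add: sum.distrib)
  also have "\<dots> = (\<Sum>v\<in>V. real (\<Sum>\<tau>\<leftarrow>ts. deliver \<tau> v) * c0 v)"
    by (intro sum.cong refl, induction ts) (simp_all add: distrib_right)
  also have "\<dots> = Delta I"
    by (simp add: served Delta_def)
  finally show "solution_cost I ts \<le> detour_rate * Delta I + 2 * (\<Sum>v\<in>small_customers I. key v)"
    using ps by (simp add: partial_solution_def)
qed

definition loads_ok :: "'v set \<Rightarrow> ('v \<Rightarrow> 'v tour) \<Rightarrow> bool" where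
  "loads_ok U B \<longleftrightarrow> (\<forall>u\<in>U. if u \<in> small_customers I then 2 * load (B u) \<le> k
     else k < 2 * load (B u) \<and> load (B u) \<le> k)"

lemma loads_ok_initial: "loads_ok V (demand_bag d)"
  using demand_le_capacity by (auto simp: loads_ok_def small_customers_iff)

lemma partial_solution_close:
  assumes ps: "partial_solution key U B ts" and loads: "loads_ok U B" and v: "v \<in> U" "key v = c0 v"
    and detour: "cheapest_detour (walk (B v)) x u"
  shows "partial_solution key (U - {v}) B (ts @ [depot_tour u x (B v)])"
proof (cases "v \<in> small_customers I")
  case True
  then have "load (B v) \<le> k"
    using loads v(1) by (auto simp: loads_ok_def)
  then show ?thesis
    using partial_solution_close_light[OF ps v(1) True v(2) _ detour] by simp
next
  case False
  then have "k < 2 * load (B v)" "load (B v) \<le> k"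
    using loads v(1) by (auto simp: loads_ok_def)
  then have "partial_solution key (U - {v}) (B(v := empty_bag v)) (ts @ [depot_tour u x (B v)])"
    using partial_solution_drop_empty[OF partial_solution_emit[OF ps v(1) _ _ detour] v(1) False]
    by simp
  then show ?thesis
    using partial_solution_cong[of "U - {v}" B "B(v := empty_bag v)"] by simp
qed

lemma loads_ok_mono: "loads_ok U B \<Longrightarrow> U' \<subseteq> U \<Longrightarrow> loads_ok U' B"
  by (auto simp: loads_ok_def)

lemma length_walk_le:
  assumes ps: "partial_solution key U B ts" and u: "u \<in> U"
  shows "length (walk (B u)) \<le> 2 * card V"
proof -
  have "finite U"
    using ps finite_customers finite_subset by (auto simp: partial_solution_def)
  then have "length (walk (B u)) \<le> (\<Sum>u\<in>U. length (walk (B u)))"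
    using member_le_sum[OF u, of "\<lambda>u. length (walk (B u))"] by simp
  then show ?thesis
    using ps by (simp add: partial_solution_def)
qed

end

section \<open>The program\<close>

abbreviation num_customers :: nexp where
  "num_customers \<equiv> Var Header"
abbreviation num_depots :: nexp where
  "num_depots \<equiv> NArr2 Header (NConst 0) (NConst 1)"
abbreviation vehicle_capacity :: nexp where
  "vehicle_capacity \<equiv> NArr2 Header (NConst 0) (NConst 2)"
abbreviation double :: "nexp \<Rightarrow> nexp" where
  "double e \<equiv> NAdd e e"
abbreviation of_target :: "narray \<Rightarrow> nexp" where
  "of_target a \<equiv> NArr a (Var Target)"
abbreviation of_processed :: "narray \<Rightarrow> nexp" where
  "of_processed a \<equiv> NArr a (Var Processed)"
abbreviation target_row :: "narray \<Rightarrow> nexp \<Rightarrow> nexp" where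
  "target_row a \<equiv> NArr2 a (Var Target)"
abbreviation processed_row :: "narray \<Rightarrow> nexp \<Rightarrow> nexp" where
  "processed_row a \<equiv> NArr2 a (Var Processed)"
abbreviation depot_vertex :: "nexp \<Rightarrow> nexp" where
  "depot_vertex u \<equiv> NAdd num_customers u"

definition nearest_depot_com :: com where
  "nearest_depot_com =
     argmin_com Position num_depots (\<lambda>_. NLess (NConst 0) (NConst 1))
       (\<lambda>u. RArr2 Weight (depot_vertex u) (Var Outer)) ;;
     NPut Nearest_Depot (Var Outer) (depot_vertex (Var Position)) ;;
     RPut Depot_Dist (Var Outer) (RArr2 Weight (depot_vertex (Var Position)) (Var Outer))"

definition open_bag_com :: com where
  "open_bag_com =
     RPut Key (Var Outer) (RArr Depot_Dist (Var Outer)) ;;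
     NPut Load (Var Outer) (NArr Demand (Var Outer)) ;;
     NPut Route_Length (Var Outer) (NConst 1) ;;
     NPut Route (Var Outer) (Var Outer) ;;
     NPut2 Units (Var Outer) (Var Outer) (NArr Demand (Var Outer))"

definition init_step_com :: com where
  "init_step_com = nearest_depot_com ;; open_bag_com"

definition init_com :: com where
  "init_com = For Outer num_customers init_step_com"

definition relax_test :: bexp where
  "relax_test =
     BAnd (NLess (NArr Visited (Var Inner)) (NConst 1))
      (BAnd (BAnd (BNot (NLess vehicle_capacity (double (NArr Demand (Var Selected)))))
                  (BNot (NLess vehicle_capacity (double (NArr Demand (Var Inner))))))
        (RLess (RArr2 Weight (Var Selected) (Var Inner)) (RArr Key (Var Inner))))"

text \<open>Parents are stored with an offset of 1, the merged depot being 0.\<close>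

definition relax_step_com :: com where
  "relax_step_com =
     Cond relax_test
       (RPut Key (Var Inner) (RArr2 Weight (Var Selected) (Var Inner)) ;;
        NPut Parent (Var Inner) (NAdd (Var Selected) (NConst 1)))
       Skip"

definition relax_com :: com where
  "relax_com = For Inner num_customers relax_step_com"

definition select_com :: com where
  "select_com = argmin_com Selected num_customers (\<lambda>i. NLess (NArr Visited i) (NConst 1)) (RArr Key)"

definition visit_com :: com where
  "visit_com =
     NPut Visited (Var Selected) (NConst 1) ;;
     NPut Order (Var Outer) (Var Selected) ;;
     relax_com"

definition prim_step_com :: com where
  "prim_step_com = select_com ;; visit_com"

definition prim_com :: com where
  "prim_com = For Outer num_customers prim_step_com"

definition append_route_com :: com where
  "append_route_com =
     fill_com Route (Var Target) (of_target Route_Length) (of_processed Route_Length)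
       (processed_row Route (Var Inner)) ;;
     NPut2 Route (Var Target) (NAdd (of_target Route_Length) (of_processed Route_Length))
       (Var Target) ;;
     NPut Route_Length (Var Target)
       (NAdd (NAdd (of_target Route_Length) (of_processed Route_Length)) (NConst 1))"

definition add_units_com :: com where
  "add_units_com =
     fill_com Units (Var Target) (NConst 0) num_customers
       (NAdd (target_row Units (Var Inner)) (processed_row Units (Var Inner))) ;;
     NPut Load (Var Target) (NAdd (of_target Load) (of_processed Load))"

definition merge_com :: com where
  "merge_com =
     SetVar Target (NSub (of_processed Parent) (NConst 1)) ;;
     append_route_com ;;
     add_units_com"

definition nearest_position_com :: com where
  "nearest_position_com =
     argmin_com Position (of_target Route_Length) (\<lambda>_. NLess (NConst 0) (NConst 1))
       (\<lambda>q. RArr Depot_Dist (target_row Route q))"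

definition copy_rotated_com :: com where
  "copy_rotated_com =
     fill_com Tour_Walk (Var Tour_Count) (NConst 1) (NSub (of_target Route_Length) (Var Position))
       (target_row Route (NAdd (Var Position) (Var Inner))) ;;
     fill_com Tour_Walk (Var Tour_Count)
       (NAdd (NConst 1) (NSub (of_target Route_Length) (Var Position))) (Var Position)
       (target_row Route (NAdd (Var Inner) (NConst 1)))"

definition write_walk_com :: com where
  "write_walk_com =
     copy_rotated_com ;;
     NPut Tour_Walk (Var Tour_Count) (NArr Nearest_Depot (target_row Route (Var Position))) ;;
     NPut2 Tour_Walk (Var Tour_Count) (NAdd (of_target Route_Length) (NConst 1))
       (NArr Nearest_Depot (target_row Route (Var Position))) ;;
     NPut Tour_Length (Var Tour_Count) (NAdd (of_target Route_Length) (NConst 2))"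

definition write_units_com :: com where
  "write_units_com =
     fill_com Tour_Units (Var Tour_Count) (NConst 0) num_customers (target_row Units (Var Inner)) ;;
     SetVar Tour_Count (NAdd (Var Tour_Count) (NConst 1))"

definition write_tour_com :: com where
  "write_tour_com = write_walk_com ;; write_units_com"

definition empty_bag_com :: com where
  "empty_bag_com =
     fill_com Units (Var Target) (NConst 0) num_customers (NConst 0) ;;
     NPut Load (Var Target) (NConst 0) ;;
     NPut Route_Length (Var Target) (NConst 1)"

definition dispatch_com :: com where
  "dispatch_com = write_tour_com ;; empty_bag_com"

definition emit_com :: com where
  "emit_com = nearest_position_com ;; dispatch_com"

definition emit_if_heavy_com :: com where
  "emit_if_heavy_com = Cond (NLess vehicle_capacity (double (of_target Load))) emit_com Skip"

definition serve_child_com :: com where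
  "serve_child_com = merge_com ;; emit_if_heavy_com"

definition serve_root_com :: com where
  "serve_root_com = SetVar Target (Var Processed) ;; emit_com"

definition serve_step_com :: com where
  "serve_step_com =
     SetVar Processed (NArr Order (NSub (NSub num_customers (Var Outer)) (NConst 1))) ;;
     Cond (NLess (NConst 0) (of_processed Parent)) serve_child_com serve_root_com"

definition serve_com :: com where
  "serve_com = For Outer num_customers serve_step_com"

definition vrp_com :: com where
  "vrp_com = init_com ;; prim_com ;; serve_com"

section \<open>Memory contents\<close>

locale vrp_memory = vrp_instance I for I :: "'v mcvrp" +
  fixes vert :: "nat \<Rightarrow> 'v" and n m :: nat
  assumes customers: "bij_betw vert {..<n} (customers I)"
    and depots: "bij_betw vert {n..<n + m} (depots I)"
begin

lemma vert_customer: "i < n \<Longrightarrow> vert i \<in> V"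
  and vert_depot: "n \<le> i \<Longrightarrow> i < n + m \<Longrightarrow> vert i \<in> depots I"
  using customers depots by (auto simp: bij_betw_def)

lemma vert_eq_iff [simp]: "i < n \<Longrightarrow> j < n \<Longrightarrow> vert i = vert j \<longleftrightarrow> i = j"
  using customers by (auto simp: bij_betw_def inj_on_def)

lemma ex_vert: "v \<in> V \<Longrightarrow> \<exists>i<n. v = vert i"
  using customers by (auto simp: bij_betw_def)

lemma card_customers: "card V = n"
  using bij_betw_same_card[OF customers] by simp

lemma num_depots_pos: "0 < m"
  using depots depots_nonempty by (auto simp: bij_betw_def)

definition input_ok :: "state \<Rightarrow> bool" where
  "input_ok s \<longleftrightarrow>
     narr s Header 0 0 = n \<and> narr s Header 0 1 = m \<and> narr s Header 0 2 = k \<and>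
     (\<forall>i<n. narr s Demand i 0 = d (vert i)) \<and>
     (\<forall>i<n + m. \<forall>j<n + m. rarr s Weight i j = w (vert i) (vert j))"

lemma input_ok_modifies:
  "modifies A R s s' \<Longrightarrow> input_ok s \<Longrightarrow> Header \<notin> A \<Longrightarrow> Demand \<notin> A \<Longrightarrow> Weight \<notin> R \<Longrightarrow> input_ok s'"
  by (simp add: input_ok_def modifies_def)

definition depot_ok :: "state \<Rightarrow> nat \<Rightarrow> bool" where
  "depot_ok s i \<longleftrightarrow>
     n \<le> narr s Nearest_Depot i 0 \<and> narr s Nearest_Depot i 0 < n + m \<and>
     w (vert (narr s Nearest_Depot i 0)) (vert i) = c0 (vert i) \<and>
     rarr s Depot_Dist i 0 = c0 (vert i)"

lemma depot_ok_modifies: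
  "modifies A R s s' \<Longrightarrow> depot_ok s i \<Longrightarrow> Nearest_Depot \<notin> A \<Longrightarrow> Depot_Dist \<notin> R \<Longrightarrow> depot_ok s' i"
  by (simp add: depot_ok_def modifies_def)

definition stores_link :: "state \<Rightarrow> nat \<Rightarrow> 'v option \<Rightarrow> real \<Rightarrow> bool" where
  "stores_link s i p r \<longleftrightarrow> rarr s Key i 0 = r \<and> narr s Parent i 0 \<le> n \<and>
     p = (case narr s Parent i 0 of 0 \<Rightarrow> None | Suc j \<Rightarrow> Some (vert j))"

definition stores_links :: "('v \<Rightarrow> 'v option) \<Rightarrow> ('v \<Rightarrow> real) \<Rightarrow> state \<Rightarrow> bool" where
  "stores_links par key s \<longleftrightarrow> (\<forall>i<n. stores_link s i (par (vert i)) (key (vert i)))"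

definition stores_prim :: "'v list \<Rightarrow> ('v \<Rightarrow> 'v option) \<Rightarrow> ('v \<Rightarrow> real) \<Rightarrow> state \<Rightarrow> bool" where
  "stores_prim xs par key s \<longleftrightarrow>
     (\<forall>t<length xs. narr s Order t 0 < n \<and> xs ! t = vert (narr s Order t 0)) \<and>
     (\<forall>i<n. narr s Visited i 0 = of_bool (vert i \<in> set xs)) \<and>
     stores_links par key s"

lemma depot_ok_set_narr [simp]:
  "a \<noteq> Nearest_Depot \<Longrightarrow> depot_ok (set_narr a p q x s) i \<longleftrightarrow> depot_ok s i"
  by (simp add: depot_ok_def)

lemma stores_link_set [simp]:
  "a \<noteq> Parent \<Longrightarrow> stores_link (set_narr a p q x s) i l r \<longleftrightarrow> stores_link s i l r"
  by (simp add: stores_link_def)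

definition bag_row :: "state \<Rightarrow> nat \<Rightarrow> nat \<times> nat \<times> (nat \<Rightarrow> nat) \<times> (nat \<Rightarrow> nat)" where
  "bag_row s i = (narr s Load i 0, narr s Route_Length i 0, narr s Route i, narr s Units i)"

definition stores_route :: "state \<Rightarrow> nat \<Rightarrow> 'v list \<Rightarrow> bool" where
  "stores_route s i l \<longleftrightarrow> narr s Route_Length i 0 = length l \<and>
     (\<forall>q<length l. narr s Route i q < n \<and> l ! q = vert (narr s Route i q))"

definition stores_bag :: "state \<Rightarrow> nat \<Rightarrow> 'v tour \<Rightarrow> bool" where
  "stores_bag s i \<beta> \<longleftrightarrow>
     narr s Load i 0 = load \<beta> \<and> stores_route s i (walk \<beta>) \<and>
     (\<forall>j<n. narr s Units i j = deliver \<beta> (vert j))"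

lemma stores_bag_set_narr [simp]:
  "a \<notin> {Load, Route_Length, Route, Units} \<Longrightarrow> stores_bag (set_narr a p q x s) i \<beta> \<longleftrightarrow> stores_bag s i \<beta>"
  by (auto simp: stores_bag_def stores_route_def)

lemma stores_bag_cong: "bag_row s' i = bag_row s i \<Longrightarrow> stores_bag s' i \<beta> \<longleftrightarrow> stores_bag s i \<beta>"
  by (simp add: bag_row_def stores_bag_def stores_route_def)

definition tour_row :: "state \<Rightarrow> nat \<Rightarrow> nat \<times> (nat \<Rightarrow> nat) \<times> (nat \<Rightarrow> nat)" where
  "tour_row s t = (narr s Tour_Length t 0, narr s Tour_Walk t, narr s Tour_Units t)"

definition stores_tour_walk :: "state \<Rightarrow> nat \<Rightarrow> 'v list \<Rightarrow> bool" where
  "stores_tour_walk s t l \<longleftrightarrow> narr s Tour_Length t 0 = length l \<and>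
     (\<forall>q<length l. narr s Tour_Walk t q < n + m \<and> l ! q = vert (narr s Tour_Walk t q))"

definition stores_tour :: "state \<Rightarrow> nat \<Rightarrow> 'v tour \<Rightarrow> bool" where
  "stores_tour s t \<tau> \<longleftrightarrow>
     stores_tour_walk s t (walk \<tau>) \<and> (\<forall>j<n. narr s Tour_Units t j = deliver \<tau> (vert j))"

lemma stores_tour_cong: "tour_row s' t = tour_row s t \<Longrightarrow> stores_tour s' t \<tau> \<longleftrightarrow> stores_tour s t \<tau>"
  by (simp add: tour_row_def stores_tour_def stores_tour_walk_def)

definition stores :: "'v set \<Rightarrow> ('v \<Rightarrow> 'v tour) \<Rightarrow> 'v tour list \<Rightarrow> state \<Rightarrow> bool" where
  "stores U B ts s \<longleftrightarrow>
     (\<forall>i<n. vert i \<in> U \<longrightarrow> stores_bag s i (B (vert i))) \<and>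
     nvar s Tour_Count = length ts \<and> (\<forall>t<length ts. stores_tour s t (ts ! t))"

lemma stores_modifies:
  assumes "modifies A R s s'"
    and "A \<inter> {Load, Route_Length, Route, Units, Tour_Count, Tour_Length, Tour_Walk, Tour_Units} = {}"
  shows "stores U B ts s' \<longleftrightarrow> stores U B ts s"
  using assms by (simp add: stores_def stores_bag_def stores_route_def stores_tour_def
      stores_tour_walk_def modifies_def)

section \<open>Initialisation\<close>

lemma is_arg_min_depot_dist:
  assumes "is_arg_min (\<lambda>u. w (vert (n + u)) v) (\<lambda>u. u < m) u"
  shows "w (vert (n + u)) v = c0 v"
proof -
  have "depots I = vert ` (+) n ` {..<m}"
    using depots by (simp add: bij_betw_def lessThan_atLeast0 add.commute)
  then have "(\<lambda>u. w u v) ` depots I = (\<lambda>u. w (vert (n + u)) v) ` {..<m}"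
    by (simp add: image_image)
  then show ?thesis
    using assms unfolding depot_dist_def
    by (intro Min_eqI[symmetric]) (auto simp: is_arg_min_linorder)
qed

lemma runs_nearest_depot:
  assumes input: "input_ok s" and i: "nvar s Outer = i" "i < n"
  shows "runs nearest_depot_com s (5 + m * 4) (\<lambda>s'.
    modifies {Inner, Position, Nearest_Depot} {Depot_Dist} s s' \<and> depot_ok s' i \<and>
    (\<forall>j. j \<noteq> i \<longrightarrow> narr s' Nearest_Depot j = narr s Nearest_Depot j \<and>
      rarr s' Depot_Dist j = rarr s Depot_Dist j))"
    (is "runs _ _ _ ?Q")
proof -
  let ?f = "\<lambda>u. rarr s Weight (n + u) i"
  have select: "runs (argmin_com Position num_depots (\<lambda>_. NLess (NConst 0) (NConst 1))
      (\<lambda>u. RArr2 Weight (depot_vertex u) (Var Outer))) s (3 + m * 4)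
    (\<lambda>s'. modifies {Inner, Position} {} s s' \<and> is_arg_min ?f (\<lambda>u. u < m \<and> True) (nvar s' Position))"
    by (rule runs_argmin) (use input i num_depots_pos in \<open>auto simp: input_ok_def modifies_def\<close>)
  have "runs nearest_depot_com s ((3 + m * 4) + 2) ?Q"
    unfolding nearest_depot_com_def
  proof (rule runs_Seq[OF select])
    fix t
    assume t: "modifies {Inner, Position} {} s t \<and> is_arg_min ?f (\<lambda>u. u < m \<and> True) (nvar t Position)"
    let ?u = "nvar t Position"
    have u: "?u < m"
      using t by (simp add: is_arg_min_def)
    have "w (vert (n + ?u)) (vert i) = c0 (vert i)"
      using t input i(2) by (intro is_arg_min_depot_dist) (auto simp: is_arg_min_linorder input_ok_def)
    then show "runs (NPut Nearest_Depot (Var Outer) (depot_vertex (Var Position)) ;;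
        RPut Depot_Dist (Var Outer) (RArr2 Weight (depot_vertex (Var Position)) (Var Outer))) t 2 ?Q"
      using t u input i by (intro runs_assign) (auto simp: modifies_def depot_ok_def input_ok_def)
  qed
  then show ?thesis
    by (rule runs_mono) simp_all
qed

lemma runs_open_bag:
  assumes input: "input_ok s" and i: "nvar s Outer = i" "i < n" and "narr s Units i = (\<lambda>_. 0)"
  shows "runs open_bag_com s 5 (\<lambda>s'.
    modifies {Load, Route_Length, Route, Units} {Key} s s' \<and>
    stores_bag s' i (demand_bag d (vert i)) \<and> rarr s' Key i 0 = rarr s Depot_Dist i 0 \<and>
    (\<forall>j. j \<noteq> i \<longrightarrow> bag_row s' j = bag_row s j \<and> rarr s' Key j = rarr s Key j))"
  unfolding open_bag_com_def
  by (intro runs_assign)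
    (use assms in \<open>auto simp: modifies_def input_ok_def stores_bag_def stores_route_def bag_row_def
      vert_customer\<close>)

definition init_ok :: "state \<Rightarrow> nat \<Rightarrow> bool" where
  "init_ok s i \<longleftrightarrow>
     depot_ok s i \<and> stores_bag s i (demand_bag d (vert i)) \<and> rarr s Key i 0 = c0 (vert i)"

definition init_row :: "state \<Rightarrow> nat \<Rightarrow>
    (nat \<Rightarrow> nat) \<times> (nat \<Rightarrow> real) \<times> (nat \<Rightarrow> real) \<times> nat \<times> nat \<times> (nat \<Rightarrow> nat) \<times> (nat \<Rightarrow> nat)" where
  "init_row s i = (narr s Nearest_Depot i, rarr s Depot_Dist i, rarr s Key i, bag_row s i)"

lemma init_ok_cong: "init_row s' i = init_row s i \<Longrightarrow> init_ok s' i \<longleftrightarrow> init_ok s i"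
  using stores_bag_cong[of s' i s] by (simp add: init_row_def init_ok_def depot_ok_def)

abbreviation init_arrays :: "narray set" where
  "init_arrays \<equiv> {Inner, Position, Nearest_Depot, Load, Route_Length, Route, Units}"

lemma runs_init_step:
  assumes input: "input_ok s" and i: "nvar s Outer = i" "i < n" and units: "narr s Units i = (\<lambda>_. 0)"
  shows "runs init_step_com s (10 + m * 4) (\<lambda>s'.
    modifies init_arrays {Depot_Dist, Key} s s' \<and> init_ok s' i \<and>
    (\<forall>j. j \<noteq> i \<longrightarrow> init_row s' j = init_row s j))"
    (is "runs _ _ _ ?Q")
proof -
  have "runs init_step_com s ((5 + m * 4) + 5) ?Q"
    unfolding init_step_com_def
  proof (rule runs_Seq[OF runs_nearest_depot[OF input i]])
    fix t
    assume t: "modifies {Inner, Position, Nearest_Depot} {Depot_Dist} s t \<and> depot_ok t i \<and>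
      (\<forall>j. j \<noteq> i \<longrightarrow> narr t Nearest_Depot j = narr s Nearest_Depot j \<and>
        rarr t Depot_Dist j = rarr s Depot_Dist j)"
    have "input_ok t"
      by (rule input_ok_modifies[OF conjunct1[OF t] input]) simp_all
    moreover have "nvar t Outer = i" "narr t Units i = (\<lambda>_. 0)"
      using t i(1) units by (simp_all add: modifies_def)
    ultimately show "runs open_bag_com t 5 ?Q"
      by (intro runs_mono[OF runs_open_bag[OF _ _ i(2)] order_refl])
        (use t in \<open>auto simp: init_ok_def init_row_def depot_ok_def bag_row_def modifies_def\<close>)
  qed
  then show ?thesis
    by (rule runs_mono) simp_all
qed

lemma runs_init:
  assumes input: "input_ok s" and units: "narr s Units = (\<lambda>_ _. 0)"
  shows "runs init_com s (2 + n * (12 + m * 4)) (\<lambda>s'.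
    modifies (insert Outer init_arrays) {Depot_Dist, Key} s s' \<and> (\<forall>i<n. init_ok s' i))"
proof -
  let ?frame = "modifies (insert Outer init_arrays) {Depot_Dist, Key} s"
  let ?Q = "\<lambda>i s'. ?frame s' \<and> (\<forall>j<i. init_ok s' j) \<and> (\<forall>j\<ge>i. narr s' Units j = (\<lambda>_. 0))"
  have "runs init_com s (2 + n * ((10 + m * 4) + 2)) (?Q n)"
    unfolding init_com_def
  proof (rule runs_For[where Q = ?Q])
    fix i t
    assume i: "i < n" and Q: "?Q i t" and t: "nvar t Outer = i"
    have input_t: "input_ok t"
      by (rule input_ok_modifies[OF conjunct1[OF Q] input]) simp_all
    have units_t: "narr t Units i = (\<lambda>_. 0)"
      using Q by simp
    show "runs init_step_com t (10 + m * 4) (\<lambda>s'. nvar s' Outer = i \<and> ?Q (Suc i) s')"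
    proof (rule runs_mono[OF runs_init_step[OF input_t t i units_t] order_refl])
      fix s'
      assume s': "modifies init_arrays {Depot_Dist, Key} t s' \<and> init_ok s' i \<and>
        (\<forall>j. j \<noteq> i \<longrightarrow> init_row s' j = init_row t j)"
      have "init_ok s' j" if "j < i" for j
        using that Q s' init_ok_cong[of s' j t] by simp
      moreover have "\<forall>j\<ge>Suc i. narr s' Units j = (\<lambda>_. 0)"
        using s' Q by (simp add: init_row_def bag_row_def)
      ultimately show "nvar s' Outer = i \<and> ?Q (Suc i) s'"
        using s' Q t by (auto simp: modifies_def less_Suc_eq)
    qed
  next
    show "?Q i (set_narr Outer 0 0 j t)" if "?Q i t" for i j t
      using that by (simp add: init_ok_def)
  qed (use input units in \<open>auto simp: input_ok_def modifies_def\<close>)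
  then show ?thesis
    by (rule runs_mono) simp_all
qed

section \<open>Prim's algorithm in memory\<close>

lemma bval_relax_test:
  assumes input: "input_ok s" and i: "nvar s Inner = i" "i < n" and b: "nvar s Selected = b" "b < n"
    and visited: "narr s Visited i 0 = of_bool (vert i \<in> set (xs @ [vert b]))"
    and key: "rarr s Key i 0 = key (vert i)"
  shows "bval relax_test s \<longleftrightarrow> relaxes xs (vert b) key (vert i)"
  using assms unfolding relax_test_def relaxes_def
  by (auto simp: input_ok_def small_customers_iff vert_customer)

lemma stores_link_cong:
  "rarr s' Key i = rarr s Key i \<Longrightarrow> narr s' Parent i = narr s Parent i \<Longrightarrow>
    stores_link s' i p r \<longleftrightarrow> stores_link s i p r"
  by (simp add: stores_link_def)

lemma runs_relax_step:
  assumes input: "input_ok s" and i: "nvar s Inner = i" "i < n" and b: "nvar s Selected = b" "b < n"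
    and visited: "narr s Visited i 0 = of_bool (vert i \<in> set (xs @ [vert b]))"
    and link: "stores_link s i (par (vert i)) (key (vert i))"
  shows "runs relax_step_com s 3 (\<lambda>s'. modifies {Parent} {Key} s s' \<and>
    stores_link s' i (relax_parent xs (vert b) key par (vert i))
      (relax_key xs (vert b) key (vert i)) \<and>
    (\<forall>j. j \<noteq> i \<longrightarrow> rarr s' Key j = rarr s Key j \<and> narr s' Parent j = narr s Parent j))"
    (is "runs _ _ _ ?Q")
  unfolding relax_step_com_def
proof (rule runs_Cond)
  have test: "bval relax_test s \<longleftrightarrow> relaxes xs (vert b) key (vert i)"
    using bval_relax_test[OF input i b visited] link by (simp add: stores_link_def)
  have weight: "rarr s Weight b i = w (vert b) (vert i)"
    using input i(2) b(2) by (simp add: input_ok_def)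
  show "runs (RPut Key (Var Inner) (RArr2 Weight (Var Selected) (Var Inner)) ;;
      NPut Parent (Var Inner) (NAdd (Var Selected) (NConst 1))) s (3 - 1) ?Q"
    if "bval relax_test s"
    using that test b(2)
    by (intro runs_assign)
      (simp_all add: i b weight Suc_le_eq stores_link_def relax_parent_def relax_key_def)
  show "runs Skip s (3 - 1) ?Q" if "\<not> bval relax_test s"
    using that test link by (intro runs_Skip) (simp_all add: relax_parent_def relax_key_def)
qed simp

lemma runs_relax:
  assumes input: "input_ok s" and b: "nvar s Selected = b" "b < n"
    and visited: "\<forall>i<n. narr s Visited i 0 = of_bool (vert i \<in> set (xs @ [vert b]))"
    and links: "stores_links par key s"
  shows "runs relax_com s (2 + n * 5) (\<lambda>s'. modifies {Inner, Parent} {Key} s s' \<and>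
    stores_links (relax_parent xs (vert b) key par) (relax_key xs (vert b) key) s')"
proof -
  let ?par = "relax_parent xs (vert b) key par" and ?key = "relax_key xs (vert b) key"
  let ?new = "\<lambda>s' j. stores_link s' j (?par (vert j)) (?key (vert j))"
  let ?old = "\<lambda>s' j. stores_link s' j (par (vert j)) (key (vert j))"
  let ?Q = "\<lambda>i s'. modifies {Inner, Parent} {Key} s s' \<and>
    (\<forall>j<n. if j < i then ?new s' j else ?old s' j)"
  have "runs relax_com s (2 + n * (3 + 2)) (?Q n)"
    unfolding relax_com_def
  proof (rule runs_For[where Q = ?Q])
    fix i t
    assume i: "i < n" and Q: "?Q i t" and t: "nvar t Inner = i"
    have input_t: "input_ok t"
      by (rule input_ok_modifies[OF conjunct1[OF Q] input]) simp_all
    have "?old t i" "nvar t Selected = b" "narr t Visited i 0 = of_bool (vert i \<in> set (xs @ [vert b]))"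
      using Q i b(1) visited by (auto simp: modifies_def)
    note step = runs_relax_step[OF input_t t i this(2) b(2) this(3),
        where par = par and key = key, OF this(1)]
    show "runs relax_step_com t 3 (\<lambda>s'. nvar s' Inner = i \<and> ?Q (Suc i) s')"
    proof (rule runs_mono[OF step order_refl])
      fix s'
      assume s': "modifies {Parent} {Key} t s' \<and> ?new s' i \<and>
        (\<forall>j. j \<noteq> i \<longrightarrow> rarr s' Key j = rarr t Key j \<and> narr s' Parent j = narr t Parent j)"
      have "if j < Suc i then ?new s' j else ?old s' j" if "j < n" for j
        using s' Q that stores_link_cong[of s' j t] by (cases "j = i") (simp_all add: less_Suc_eq)
      then show "nvar s' Inner = i \<and> ?Q (Suc i) s'"
        using s' Q t by (simp add: modifies_def)
    qed
  next
    show "?Q i (set_narr Inner 0 0 j t)" if "?Q i t" for i j t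
      using that by simp
  qed (use input links in \<open>auto simp: input_ok_def modifies_def stores_links_def\<close>)
  then show ?thesis
    by (rule runs_mono) (auto simp: stores_links_def)
qed

lemma runs_select:
  assumes input: "input_ok s" and xs: "length xs < n" and stored: "stores_prim xs par key s"
  shows "runs select_com s (3 + n * 4) (\<lambda>s'. modifies {Inner, Selected} {} s s' \<and>
    (\<exists>b<n. nvar s' Selected = b \<and> vert b \<in> V - set xs \<and> (\<forall>v\<in>V - set xs. key (vert b) \<le> key v)))"
proof -
  let ?unvisited = "\<lambda>i. narr s Visited i 0 < 1"
  let ?f = "\<lambda>i. rarr s Key i 0"
  have unvisited: "?unvisited i \<longleftrightarrow> vert i \<notin> set xs" and f: "?f i = key (vert i)" if "i < n" for i
    using stored that by (simp_all add: stores_prim_def stores_links_def stores_link_def)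
  have "card (set xs) < card V"
    using xs card_length[of xs] by (simp add: card_customers)
  then obtain v where "v \<in> V" "v \<notin> set xs"
    by (metis List.finite_set card_mono leD subsetI)
  then have ex: "\<exists>i<n. ?unvisited i"
    using ex_vert unvisited by metis
  have select: "runs select_com s (3 + n * 4)
    (\<lambda>s'. modifies {Inner, Selected} {} s s' \<and>
      is_arg_min ?f (\<lambda>i. i < n \<and> ?unvisited i) (nvar s' Selected))"
    unfolding select_com_def
    by (rule runs_argmin[OF _ ex]) (use input in \<open>auto simp: input_ok_def modifies_def\<close>)
  have "b < n \<and> vert b \<in> V - set xs \<and> (\<forall>v\<in>V - set xs. key (vert b) \<le> key v)"
    if "is_arg_min ?f (\<lambda>i. i < n \<and> ?unvisited i) b" for b
  proof -
    have b: "b < n" "?unvisited b" "\<And>i. i < n \<Longrightarrow> ?unvisited i \<Longrightarrow> ?f b \<le> ?f i"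
      using that by (simp_all add: is_arg_min_linorder)
    have "key (vert b) \<le> key v" if v: "v \<in> V - set xs" for v
      using v b f unvisited ex_vert by (metis DiffD1 DiffD2)
    then show ?thesis
      using b(1,2) unvisited vert_customer by simp
  qed
  then show ?thesis
    by (intro runs_mono[OF select order_refl]) blast
qed

lemma stores_prim_snoc:
  assumes stored: "stores_prim xs par key s" and b: "b < n"
    and order: "narr s' Order = (narr s Order)(length xs := (narr s Order (length xs))(0 := b))"
    and visited: "narr s' Visited = (narr s Visited)(b := (narr s Visited b)(0 := 1))"
    and links: "stores_links par' key' s'"
  shows "stores_prim (xs @ [vert b]) par' key' s'"
  using assms by (auto simp: stores_prim_def nth_append less_Suc_eq)

definition prim_stage :: "nat \<Rightarrow> state \<Rightarrow> bool" where
  "prim_stage i s \<longleftrightarrow>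
     (\<exists>xs par key. length xs = i \<and> prim_inv xs par key \<and> stores_prim xs par key s)"

lemma runs_visit:
  assumes input: "input_ok s" and stored: "stores_prim xs par key s"
    and outer: "nvar s Outer = length xs" and b: "nvar s Selected = b" "b < n"
  shows "runs visit_com s (4 + n * 5) (\<lambda>s'.
    modifies {Inner, Visited, Order, Parent} {Key} s s' \<and>
    stores_prim (xs @ [vert b]) (relax_parent xs (vert b) key par) (relax_key xs (vert b) key) s')"
    (is "runs _ _ _ ?Q")
proof -
  let ?s = "set_narr Order (length xs) 0 b (set_narr Visited b 0 1 s)"
  have frame: "modifies {Visited, Order} {} s ?s"
    by simp
  have input': "input_ok ?s"
    by (rule input_ok_modifies[OF frame input]) simp_all
  have selected: "nvar ?s Selected = b"
    using b(1) by simp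
  have visited: "\<forall>i<n. narr ?s Visited i 0 = of_bool (vert i \<in> set (xs @ [vert b]))"
    and links: "stores_links par key ?s"
    using stored b(2) by (auto simp: stores_prim_def stores_links_def)
  have "runs relax_com ?s (2 + n * 5) ?Q"
    by (rule runs_mono[OF runs_relax[OF input' selected b(2) visited links] order_refl])
      (auto simp: modifies_def intro!: stores_prim_snoc[OF stored b(2)])
  then show ?thesis
    unfolding visit_com_def by (intro runs_assign) (simp_all add: b(1) outer)
qed

lemma runs_prim_step:
  assumes input: "input_ok s" and outer: "nvar s Outer = i" "i < n" and stage: "prim_stage i s"
  shows "runs prim_step_com s (7 + n * 9) (\<lambda>s'.
    modifies {Inner, Selected, Visited, Order, Parent} {Key} s s' \<and> prim_stage (Suc i) s')"
    (is "runs _ _ _ ?Q")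
proof -
  obtain xs par key where xs: "length xs = i" and inv: "prim_inv xs par key"
    and stored: "stores_prim xs par key s"
    using stage by (auto simp: prim_stage_def)
  have unfinished: "length xs < n"
    using xs outer(2) by simp
  have "runs prim_step_com s ((3 + n * 4) + (4 + n * 5)) ?Q"
    unfolding prim_step_com_def
  proof (rule runs_Seq[OF runs_select[OF input unfinished stored]], elim conjE exE)
    fix t b
    assume t: "modifies {Inner, Selected} {} s t" and b: "b < n" "nvar t Selected = b"
      and min: "vert b \<in> V - set xs" "\<forall>v\<in>V - set xs. key (vert b) \<le> key v"
    have input_t: "input_ok t"
      by (rule input_ok_modifies[OF t input]) simp_all
    have stored_t: "stores_prim xs par key t" and outer_t: "nvar t Outer = length xs"
      using t stored outer(1) xs
      by (simp_all add: modifies_def stores_prim_def stores_links_def stores_link_def)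
    show "runs visit_com t (4 + n * 5) ?Q"
    proof (rule runs_mono[OF runs_visit[OF input_t stored_t outer_t b(2,1)] order_refl], elim conjE)
      fix s'
      assume frame: "modifies {Inner, Visited, Order, Parent} {Key} t s'"
        and stored': "stores_prim (xs @ [vert b])
          (relax_parent xs (vert b) key par) (relax_key xs (vert b) key) s'"
      have "prim_stage (Suc i) s'"
        using prim_inv_snoc[OF inv min] stored' xs
        unfolding prim_stage_def by (metis length_append_singleton)
      then show "?Q s'"
        using t frame by (simp add: modifies_def)
    qed
  qed
  then show ?thesis
    by (rule runs_mono) simp_all
qed

lemma runs_prim:
  assumes input: "input_ok s" and blank: "narr s Visited = (\<lambda>_ _. 0)" "narr s Parent = (\<lambda>_ _. 0)"
    and key: "\<forall>i<n. rarr s Key i 0 = c0 (vert i)"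
  shows "runs prim_com s (2 + n * (9 + n * 9)) (\<lambda>s'.
    modifies {Outer, Inner, Selected, Visited, Order, Parent} {Key} s s' \<and> prim_stage n s')"
proof -
  let ?Q = "\<lambda>i s'. modifies {Outer, Inner, Selected, Visited, Order, Parent} {Key} s s' \<and> prim_stage i s'"
  have "runs prim_com s (2 + n * ((7 + n * 9) + 2)) (?Q n)"
    unfolding prim_com_def
  proof (rule runs_For[where Q = ?Q])
    have "stores_prim [] (\<lambda>_. None) c0 s"
      using blank key by (simp add: stores_prim_def stores_links_def stores_link_def)
    then show "?Q 0 s"
      using prim_inv_Nil by (auto simp: prim_stage_def)
  next
    fix i t
    assume i: "i < n" and Q: "?Q i t" and t: "nvar t Outer = i"
    have input_t: "input_ok t"
      by (rule input_ok_modifies[OF conjunct1[OF Q] input]) simp_all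
    show "runs prim_step_com t (7 + n * 9) (\<lambda>s'. nvar s' Outer = i \<and> ?Q (Suc i) s')"
      by (rule runs_mono[OF runs_prim_step[OF input_t t i conjunct2[OF Q]] order_refl])
        (use Q t in \<open>auto simp: modifies_def\<close>)
  next
    show "?Q i (set_narr Outer 0 0 j t)" if "?Q i t" for i j t
      using that by (simp add: prim_stage_def stores_prim_def stores_links_def)
  qed (use input in \<open>auto simp: input_ok_def modifies_def\<close>)
  then show ?thesis
    by (rule runs_mono) simp_all
qed

lemma prim_stage_final:
  assumes "prim_stage n s"
  obtains xs par key where "prim_inv xs par key" "set xs = V" "stores_prim xs par key s"
  using assms prim_inv_complete card_customers unfolding prim_stage_def by metis

section \<open>Merging and emitting bags in memory\<close>

lemma stores_mono: "stores U B ts s \<Longrightarrow> U' \<subseteq> U \<Longrightarrow> stores U' B ts s"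
  by (auto simp: stores_def)

lemma stores_update_bag:
  assumes "stores U B ts s" "modifies A R s s'"
    and "A \<inter> {Tour_Count, Tour_Length, Tour_Walk, Tour_Units} = {}"
    and "r < n" "stores_bag s' r \<beta>" "\<forall>j. j \<noteq> r \<longrightarrow> bag_row s' j = bag_row s j"
  shows "stores U (B(vert r := \<beta>)) ts s'"
proof -
  have "stores_tour s' t \<tau> \<longleftrightarrow> stores_tour s t \<tau>" for t \<tau>
    using assms(2,3) by (simp add: stores_tour_def stores_tour_walk_def modifies_def)
  moreover have "nvar s' Tour_Count = nvar s Tour_Count"
    using assms(2,3) by (simp add: modifies_def)
  ultimately show ?thesis
    using assms(1,4-6) stores_bag_cong[of s' _ s] by (auto simp: stores_def)
qed

lemma stores_snoc_tour:
  assumes "stores U B ts s" "modifies A R s s'" "A \<inter> {Load, Route_Length, Route, Units} = {}"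
    and "nvar s' Tour_Count = Suc (length ts)" "stores_tour s' (length ts) \<tau>"
    and "\<forall>t. t \<noteq> length ts \<longrightarrow> tour_row s' t = tour_row s t"
  shows "stores U B (ts @ [\<tau>]) s'"
proof -
  have "stores_bag s' i \<beta> \<longleftrightarrow> stores_bag s i \<beta>" for i \<beta>
    using assms(2,3) by (simp add: stores_bag_def stores_route_def modifies_def)
  then show ?thesis
    using assms(1,4-6) stores_tour_cong[of s' _ s] by (auto simp: stores_def nth_append less_Suc_eq)
qed

lemma runs_append_route:
  assumes r: "nvar s Target = r" "r < n" and v: "nvar s Processed = v" "v \<noteq> r"
    and routes: "stores_route s r l" "stores_route s v l'"
  shows "runs append_route_com s (4 + 3 * length l') (\<lambda>s'.
    modifies {Inner, Route, Route_Length} {} s s' \<and> stores_route s' r (l @ l' @ [vert r]) \<and>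
    (\<forall>j. j \<noteq> r \<longrightarrow> narr s' Route j = narr s Route j \<and> narr s' Route_Length j = narr s Route_Length j))"
    (is "runs _ _ _ ?Q")
proof -
  let ?L = "length l + length l'"
  let ?copied = "\<lambda>t. modifies {Inner, Route} {} s t \<and>
    narr t Route = fill_row r (length l) (narr s Route v) (length l') (narr s Route)"
  have copy: "runs (fill_com Route (Var Target) (of_target Route_Length) (of_processed Route_Length)
      (processed_row Route (Var Inner))) s (2 + length l' * 3) ?copied"
    by (rule runs_fill) (use r v routes in \<open>auto simp: modifies_def stores_route_def fill_row_def\<close>)
  have "runs append_route_com s ((2 + length l' * 3) + 2) ?Q"
    unfolding append_route_com_def
  proof (rule runs_Seq[OF copy])
    fix t
    assume t: "?copied t"
    let ?t = "set_narr Route_Length r 0 (Suc ?L) (set_narr Route r ?L r t)"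
    have "stores_route ?t r (l @ l' @ [vert r])"
      using t r(2) routes by (auto simp: stores_route_def modifies_def fill_row_def nth_append)
    then have "?Q ?t"
      using t by (simp add: modifies_def fill_row_def)
    moreover have "nvar t Target = r" "nvar t Processed = v"
      "narr t Route_Length r 0 = length l" "narr t Route_Length v 0 = length l'"
      using t r v routes by (simp_all add: modifies_def stores_route_def)
    ultimately show "runs (NPut2 Route (Var Target)
         (NAdd (of_target Route_Length) (of_processed Route_Length)) (Var Target) ;;
       NPut Route_Length (Var Target)
         (NAdd (NAdd (of_target Route_Length) (of_processed Route_Length)) (NConst 1))) t 2 ?Q"
      using v(2) by (intro runs_assign) simp_all
  qed
  then show ?thesis
    by (rule runs_mono) simp_all
qed

lemma runs_add_units:
  assumes input: "input_ok s" and r: "nvar s Target = r" and v: "nvar s Processed = v" "v \<noteq> r"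
  shows "runs add_units_com s (3 + 3 * n) (\<lambda>s'.
    modifies {Inner, Units, Load} {} s s' \<and> narr s' Load r 0 = narr s Load r 0 + narr s Load v 0 \<and>
    (\<forall>j<n. narr s' Units r j = narr s Units r j + narr s Units v j) \<and>
    (\<forall>j. j \<noteq> r \<longrightarrow> narr s' Units j = narr s Units j \<and> narr s' Load j = narr s Load j))"
    (is "runs _ _ _ ?Q")
proof -
  let ?added = "\<lambda>t. modifies {Inner, Units} {} s t \<and>
    narr t Units = fill_row r 0 (\<lambda>j. narr s Units r j + narr s Units v j) n (narr s Units)"
  have add: "runs (fill_com Units (Var Target) (NConst 0) num_customers
      (NAdd (target_row Units (Var Inner)) (processed_row Units (Var Inner)))) s (2 + n * 3) ?added"
    by (rule runs_fill) (use input r v in \<open>auto simp: modifies_def fill_row_def input_ok_def\<close>)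
  have "runs add_units_com s ((2 + n * 3) + 1) ?Q"
    unfolding add_units_com_def
    by (rule runs_Seq[OF add], intro runs_assign)
      (use r v in \<open>auto simp: modifies_def fill_row_def\<close>)
  then show ?thesis
    by (rule runs_mono) simp_all
qed

lemma runs_merge_rows:
  assumes input: "input_ok s" and r: "nvar s Target = r" "r < n"
    and v: "nvar s Processed = v" "v \<noteq> r"
    and bags: "stores_bag s r \<beta>" "stores_bag s v \<gamma>" and hd: "hd (walk \<beta>) = vert r"
  shows "runs (append_route_com ;; add_units_com) s (7 + 3 * length (walk \<gamma>) + 3 * n) (\<lambda>s'.
    modifies {Inner, Load, Route_Length, Route, Units} {} s s' \<and>
    stores_bag s' r (merge_bags \<beta> \<gamma>) \<and> (\<forall>j. j \<noteq> r \<longrightarrow> bag_row s' j = bag_row s j))"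
    (is "runs _ _ _ ?Q")
proof -
  have routes: "stores_route s r (walk \<beta>)" "stores_route s v (walk \<gamma>)"
    using bags by (simp_all add: stores_bag_def)
  have walk: "walk (merge_bags \<beta> \<gamma>) = walk \<beta> @ walk \<gamma> @ [vert r]"
    using hd by (simp add: merge_bags_def)
  have "runs (append_route_com ;; add_units_com) s ((4 + 3 * length (walk \<gamma>)) + (3 + 3 * n)) ?Q"
  proof (rule runs_Seq[OF runs_append_route[OF r v routes]])
    fix t
    assume t: "modifies {Inner, Route, Route_Length} {} s t \<and>
      stores_route t r (walk \<beta> @ walk \<gamma> @ [vert r]) \<and>
      (\<forall>j. j \<noteq> r \<longrightarrow> narr t Route j = narr s Route j \<and> narr t Route_Length j = narr s Route_Length j)"
    have input_t: "input_ok t"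
      by (rule input_ok_modifies[OF conjunct1[OF t] input]) simp_all
    have vars: "nvar t Target = r" "nvar t Processed = v"
      using t r(1) v(1) by (simp_all add: modifies_def)
    show "runs add_units_com t (3 + 3 * n) ?Q"
      by (rule runs_mono[OF runs_add_units[OF input_t vars v(2)] order_refl])
        (use t bags in \<open>simp add: modifies_def stores_bag_def stores_route_def bag_row_def walk\<close>)
  qed
  then show ?thesis
    by (rule runs_mono) simp_all
qed

lemma runs_merge:
  assumes input: "input_ok s" and stored: "stores U B ts s"
    and v: "nvar s Processed = v" "v < n" "vert v \<in> U"
    and r: "narr s Parent v 0 = Suc r" "r < n" "v \<noteq> r" "vert r \<in> U" "hd (walk (B (vert r))) = vert r"
  shows "runs merge_com s (8 + 3 * length (walk (B (vert v))) + 3 * n) (\<lambda>s'.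
    modifies {Inner, Target, Load, Route_Length, Route, Units} {} s s' \<and> nvar s' Target = r \<and>
    stores U (B(vert r := merge_bags (B (vert r)) (B (vert v)))) ts s')"
    (is "runs _ _ _ ?Q")
proof -
  let ?\<beta> = "B (vert r)" and ?\<gamma> = "B (vert v)"
  let ?s = "set_narr Target 0 0 r s"
  have frame: "modifies {Target} {} s ?s"
    by simp
  have input': "input_ok ?s"
    by (rule input_ok_modifies[OF frame input]) simp_all
  have vars: "nvar ?s Target = r" "nvar ?s Processed = v"
    using v(1) by simp_all
  have stored': "stores U B ts ?s"
    using stores_modifies[OF frame] stored by simp
  then have bags: "stores_bag ?s r ?\<beta>" "stores_bag ?s v ?\<gamma>"
    using v r unfolding stores_def by blast+
  have "runs (append_route_com ;; add_units_com) ?s (7 + 3 * length (walk ?\<gamma>) + 3 * n) ?Q"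
  proof (rule runs_mono[OF runs_merge_rows[OF input' vars(1) r(2) vars(2) r(3) bags r(5)] order_refl])
    fix s'
    assume s': "modifies {Inner, Load, Route_Length, Route, Units} {} ?s s' \<and>
      stores_bag s' r (merge_bags ?\<beta> ?\<gamma>) \<and> (\<forall>j. j \<noteq> r \<longrightarrow> bag_row s' j = bag_row ?s j)"
    have "stores U (B(vert r := merge_bags ?\<beta> ?\<gamma>)) ts s'"
      using stores_update_bag[OF stored' conjunct1[OF s'] _ r(2)] s' by simp
    then show "?Q s'"
      using s' by (simp add: modifies_def)
  qed
  then have "runs merge_com s (1 + (7 + 3 * length (walk ?\<gamma>) + 3 * n)) ?Q"
    unfolding merge_com_def by (intro runs_NPut_Seq) (simp_all add: v r add.assoc)
  then show ?thesis
    by (rule runs_mono) simp_all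
qed

lemma nth_walk_depot_tour:
  assumes "x < length (walk \<beta>)" "q < length (walk \<beta>) + 2"
  shows "walk (depot_tour u x \<beta>) ! q =
    (if q = 0 \<or> q = length (walk \<beta>) + 1 then u
     else if q - 1 < length (walk \<beta>) - x then walk \<beta> ! (x + (q - 1))
     else walk \<beta> ! Suc (q - 1 - (length (walk \<beta>) - x)))"
  using assms length_rotate_closed[of x "walk \<beta>"]
  by (auto simp: depot_tour_def nth_append nth_Cons nth_rotate_closed split: nat.splits)

lemma fill_row_append:
  "fill_row r (l + N) g N' (fill_row r l f N M) =
    fill_row r l (\<lambda>q. if q < N then f q else g (q - N)) (N + N') M"
  by (auto simp: fill_row_def fun_eq_iff)

lemma runs_copy_rotated:
  assumes r: "nvar s Target = r" and t: "nvar s Tour_Count = t" and x: "nvar s Position = x" "x < L"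
    and L: "narr s Route_Length r 0 = L"
  shows "runs copy_rotated_com s (4 + 3 * L) (\<lambda>s'. modifies {Inner, Tour_Walk} {} s s' \<and>
    narr s' Tour_Walk = fill_row t 1
      (\<lambda>q. if q < L - x then narr s Route r (x + q) else narr s Route r (Suc (q - (L - x))))
      L (narr s Tour_Walk))"
    (is "runs _ _ _ ?Q")
proof -
  let ?suffix = "\<lambda>s'. modifies {Inner, Tour_Walk} {} s s' \<and>
    narr s' Tour_Walk = fill_row t 1 (\<lambda>q. narr s Route r (x + q)) (L - x) (narr s Tour_Walk)"
  let ?prefix = "\<lambda>s' s''. modifies {Inner, Tour_Walk} {} s' s'' \<and>
    narr s'' Tour_Walk = fill_row t (1 + (L - x)) (\<lambda>q. narr s Route r (Suc q)) x (narr s' Tour_Walk)"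
  have suffix: "runs (fill_com Tour_Walk (Var Tour_Count) (NConst 1)
      (NSub (of_target Route_Length) (Var Position))
      (target_row Route (NAdd (Var Position) (Var Inner))))
    s (2 + (L - x) * 3) ?suffix"
    by (rule runs_fill) (use assms in \<open>auto simp: modifies_def\<close>)
  have prefix: "runs (fill_com Tour_Walk (Var Tour_Count)
      (NAdd (NConst 1) (NSub (of_target Route_Length) (Var Position))) (Var Position)
      (target_row Route (NAdd (Var Inner) (NConst 1)))) s' (2 + x * 3) (?prefix s')"
    if "?suffix s'" for s'
    by (rule runs_fill) (use assms that in \<open>auto simp: modifies_def\<close>)
  have "?Q s''" if "?suffix s'" "?prefix s' s''" for s' s''
    using that x(2) by (simp add: modifies_def fill_row_append[of t 1 "L - x", simplified])
  then have "runs copy_rotated_com s ((2 + (L - x) * 3) + (2 + x * 3)) ?Q"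
    unfolding copy_rotated_com_def
    by (intro runs_Seq[OF suffix] runs_mono[OF prefix order_refl])
  then show ?thesis
    by (rule runs_mono) (use x(2) in simp_all)
qed

lemma stores_tour_walk_depot_tour:
  assumes route: "stores_route s r (walk \<beta>)" "x < length (walk \<beta>)" and z: "z < n + m"
    and length: "narr s' Tour_Length t 0 = length (walk \<beta>) + 2"
    and walk: "\<And>q. q < length (walk \<beta>) + 2 \<Longrightarrow> narr s' Tour_Walk t q =
      (if q = 0 \<or> q = length (walk \<beta>) + 1 then z
       else if q - 1 < length (walk \<beta>) - x then narr s Route r (x + (q - 1))
       else narr s Route r (Suc (q - 1 - (length (walk \<beta>) - x))))"
  shows "stores_tour_walk s' t (walk (depot_tour (vert z) x \<beta>))"
proof -
  have "narr s' Tour_Walk t q < n + m \<and>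
      walk (depot_tour (vert z) x \<beta>) ! q = vert (narr s' Tour_Walk t q)"
    if q: "q < length (walk \<beta>) + 2" for q
    unfolding walk[OF q] nth_walk_depot_tour[OF route(2) q]
    using q route z by (auto simp: stores_route_def intro!: trans_less_add1)
  then show ?thesis
    using length length_rotate_closed[OF route(2)] by (simp add: stores_tour_walk_def depot_tour_def)
qed

lemma runs_write_walk:
  assumes r: "nvar s Target = r" and t: "nvar s Tour_Count = t" and x: "nvar s Position = x"
    and route: "stores_route s r (walk \<beta>)" "x < length (walk \<beta>)"
    and z: "narr s Nearest_Depot (narr s Route r x) 0 = z" "z < n + m"
  shows "runs write_walk_com s (7 + 3 * length (walk \<beta>)) (\<lambda>s'.
    modifies {Inner, Tour_Walk, Tour_Length} {} s s' \<and>
    stores_tour_walk s' t (walk (depot_tour (vert z) x \<beta>)) \<and>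
    (\<forall>t'. t' \<noteq> t \<longrightarrow> narr s' Tour_Walk t' = narr s Tour_Walk t' \<and>
      narr s' Tour_Length t' = narr s Tour_Length t'))"
    (is "runs _ _ _ ?Q")
proof -
  let ?L = "length (walk \<beta>)"
  let ?rotated = "\<lambda>q. if q < ?L - x then narr s Route r (x + q)
    else narr s Route r (Suc (q - (?L - x)))"
  have L: "narr s Route_Length r 0 = ?L"
    using route(1) by (simp add: stores_route_def)
  have "runs write_walk_com s ((4 + 3 * ?L) + 3) ?Q"
    unfolding write_walk_com_def
  proof (rule runs_Seq[OF runs_copy_rotated[OF r t x route(2) L]])
    fix s'
    assume s': "modifies {Inner, Tour_Walk} {} s s' \<and>
      narr s' Tour_Walk = fill_row t 1 ?rotated ?L (narr s Tour_Walk)"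
    let ?t = "set_narr Tour_Length t 0 (?L + 2)
      (set_narr Tour_Walk t (?L + 1) z (set_narr Tour_Walk t 0 z s'))"
    have "stores_tour_walk ?t t (walk (depot_tour (vert z) x \<beta>))"
      by (rule stores_tour_walk_depot_tour[OF route z(2)]) (use s' in \<open>auto simp: fill_row_def\<close>)
    then have "?Q ?t"
      using s' by (simp add: modifies_def fill_row_def)
    moreover have "nvar s' Tour_Count = t" "nvar s' Target = r" "nvar s' Position = x"
      "narr s' Route_Length = narr s Route_Length" "narr s' Route = narr s Route"
      "narr s' Nearest_Depot = narr s Nearest_Depot"
      using s' r t x by (simp_all add: modifies_def)
    ultimately show "runs (NPut Tour_Walk (Var Tour_Count)
          (NArr Nearest_Depot (target_row Route (Var Position))) ;;
        NPut2 Tour_Walk (Var Tour_Count) (NAdd (of_target Route_Length) (NConst 1))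
          (NArr Nearest_Depot (target_row Route (Var Position))) ;;
        NPut Tour_Length (Var Tour_Count) (NAdd (of_target Route_Length) (NConst 2))) s' 3 ?Q"
      by (intro runs_assign) (simp_all add: L z(1))
  qed
  then show ?thesis
    by (rule runs_mono) simp_all
qed

lemma runs_write_units:
  assumes input: "input_ok s" and r: "nvar s Target = r" and t: "nvar s Tour_Count = t"
  shows "runs write_units_com s (3 + 3 * n) (\<lambda>s'.
    modifies {Inner, Tour_Units, Tour_Count} {} s s' \<and> nvar s' Tour_Count = Suc t \<and>
    narr s' Tour_Units = fill_row t 0 (narr s Units r) n (narr s Tour_Units))"
    (is "runs _ _ _ ?Q")
proof -
  let ?copied = "\<lambda>t'. modifies {Inner, Tour_Units} {} s t' \<and>
    narr t' Tour_Units = fill_row t 0 (narr s Units r) n (narr s Tour_Units)"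
  have copy: "runs (fill_com Tour_Units (Var Tour_Count) (NConst 0) num_customers
      (target_row Units (Var Inner))) s (2 + n * 3) ?copied"
    by (rule runs_fill) (use input r t in \<open>auto simp: modifies_def input_ok_def\<close>)
  have "runs write_units_com s ((2 + n * 3) + 1) ?Q"
    unfolding write_units_com_def
    by (rule runs_Seq[OF copy], intro runs_assign) (use t in \<open>auto simp: modifies_def\<close>)
  then show ?thesis
    by (rule runs_mono) simp_all
qed

lemma runs_write_tour:
  assumes input: "input_ok s" and stored: "stores U B ts s"
    and r: "nvar s Target = r" "r < n" "vert r \<in> U"
    and x: "nvar s Position = x" "x < length (walk (B (vert r)))"
    and z: "narr s Nearest_Depot (narr s Route r x) 0 = z" "z < n + m"
  shows "runs write_tour_com s (10 + 3 * length (walk (B (vert r))) + 3 * n) (\<lambda>s'.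
    modifies {Inner, Tour_Walk, Tour_Length, Tour_Units, Tour_Count} {} s s' \<and>
    stores U B (ts @ [depot_tour (vert z) x (B (vert r))]) s')"
    (is "runs _ _ _ ?Q")
proof -
  let ?\<beta> = "B (vert r)" and ?t = "length ts"
  let ?\<tau> = "depot_tour (vert z) x ?\<beta>"
  have bag: "stores_bag s r ?\<beta>" and t: "nvar s Tour_Count = ?t"
    using stored r by (simp_all add: stores_def)
  then have route: "stores_route s r (walk ?\<beta>)"
    by (simp add: stores_bag_def)
  have "runs write_tour_com s ((7 + 3 * length (walk ?\<beta>)) + (3 + 3 * n)) ?Q"
    unfolding write_tour_com_def
  proof (rule runs_Seq[OF runs_write_walk[OF r(1) t x(1) route x(2) z]])
    fix s1
    assume s1: "modifies {Inner, Tour_Walk, Tour_Length} {} s s1 \<and>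
      stores_tour_walk s1 ?t (walk ?\<tau>) \<and>
      (\<forall>t'. t' \<noteq> ?t \<longrightarrow> narr s1 Tour_Walk t' = narr s Tour_Walk t' \<and>
        narr s1 Tour_Length t' = narr s Tour_Length t')"
    have input1: "input_ok s1"
      by (rule input_ok_modifies[OF conjunct1[OF s1] input]) simp_all
    have vars: "nvar s1 Target = r" "nvar s1 Tour_Count = ?t"
      using s1 r(1) t by (simp_all add: modifies_def)
    show "runs write_units_com s1 (3 + 3 * n) ?Q"
    proof (rule runs_mono[OF runs_write_units[OF input1 vars] order_refl])
      fix s2
      assume s2: "modifies {Inner, Tour_Units, Tour_Count} {} s1 s2 \<and>
        nvar s2 Tour_Count = Suc ?t \<and>
        narr s2 Tour_Units = fill_row ?t 0 (narr s1 Units r) n (narr s1 Tour_Units)"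
      have frame: "modifies {Inner, Tour_Walk, Tour_Length, Tour_Units, Tour_Count} {} s s2"
        using s1 s2 by (simp add: modifies_def)
      have "stores_tour s2 ?t ?\<tau>" "\<forall>t. t \<noteq> ?t \<longrightarrow> tour_row s2 t = tour_row s t"
        using s1 s2 bag
        by (simp_all add: modifies_def stores_tour_def stores_tour_walk_def stores_bag_def
            tour_row_def fill_row_def)
      then show "?Q s2"
        using stores_snoc_tour[OF stored frame] s2 frame by simp
    qed
  qed
  then show ?thesis
    by (rule runs_mono) simp_all
qed

lemma runs_empty_bag:
  assumes input: "input_ok s" and stored: "stores U B ts s"
    and r: "nvar s Target = r" "r < n" "vert r \<in> U" and bag: "is_bag (vert r) (B (vert r))"
  shows "runs empty_bag_com s (4 + 3 * n) (\<lambda>s'.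
    modifies {Inner, Load, Route_Length, Units} {} s s' \<and>
    stores U (B(vert r := empty_bag (vert r))) ts s')"
    (is "runs _ _ _ ?Q")
proof -
  let ?zeroed = "\<lambda>t. modifies {Inner, Units} {} s t \<and>
    narr t Units = fill_row r 0 (\<lambda>_. 0) n (narr s Units)"
  have zero: "runs (fill_com Units (Var Target) (NConst 0) num_customers (NConst 0)) s
      (2 + n * 3) ?zeroed"
    by (rule runs_fill) (use input r in \<open>auto simp: modifies_def input_ok_def\<close>)
  have start: "narr s Route r 0 < n" "vert (narr s Route r 0) = vert r"
    using stored r bag
    by (auto simp: stores_def stores_bag_def stores_route_def is_bag_def hd_conv_nth)
  have "?Q (set_narr Route_Length r 0 1 (set_narr Load r 0 0 t))" if t: "?zeroed t" for t
  proof -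
    let ?t = "set_narr Route_Length r 0 1 (set_narr Load r 0 0 t)"
    have frame: "modifies {Inner, Load, Route_Length, Units} {} s ?t"
      using t by (simp add: modifies_def)
    have "stores_bag ?t r (empty_bag (vert r))" "\<forall>j. j \<noteq> r \<longrightarrow> bag_row ?t j = bag_row s j"
      using t r(2) start
      by (auto simp: modifies_def stores_bag_def stores_route_def bag_row_def fill_row_def)
    then show ?thesis
      using stores_update_bag[OF stored frame _ r(2)] frame by simp
  qed
  moreover have "nvar t Target = r" if "?zeroed t" for t
    using that r(1) by (simp add: modifies_def)
  ultimately have "runs empty_bag_com s ((2 + n * 3) + 2) ?Q"
    unfolding empty_bag_com_def by (intro runs_Seq[OF zero] runs_assign) simp_all
  then show ?thesis
    by (rule runs_mono) simp_all
qed

lemma runs_nearest_position: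
  assumes r: "nvar s Target = r" and depots: "\<forall>i<n. depot_ok s i"
    and route: "stores_route s r l" "l \<noteq> []"
  shows "runs nearest_position_com s (3 + 4 * length l) (\<lambda>s'. modifies {Inner, Position} {} s s' \<and>
    (\<exists>x z. nvar s' Position = x \<and> narr s' Nearest_Depot (narr s' Route r x) 0 = z \<and> z < n + m \<and>
      cheapest_detour l x (vert z)))"
    (is "runs _ _ _ ?Q")
proof -
  let ?f = "\<lambda>q. rarr s Depot_Dist (narr s Route r q) 0"
  let ?nearest = "\<lambda>s'. modifies {Inner, Position} {} s s' \<and>
    is_arg_min ?f (\<lambda>q. q < length l \<and> True) (nvar s' Position)"
  have nearest: "runs nearest_position_com s (3 + length l * 4) ?nearest"
    unfolding nearest_position_com_def
    by (rule runs_argmin) (use r route in \<open>auto simp: modifies_def stores_route_def\<close>)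
  have cheapest: "?Q s'" if s': "?nearest s'" for s'
  proof -
    define x where "x = nvar s' Position"
    have vertex: "depot_ok s (narr s Route r q)" "vert (narr s Route r q) = l ! q"
      if "q < length l" for q
      using that depots route by (simp_all add: stores_route_def)
    then have "?f q = c0 (l ! q)" if "q < length l" for q
      using that by (simp add: depot_ok_def)
    then have "is_arg_min (\<lambda>q. c0 (l ! q)) (\<lambda>q. q < length l) x"
      using s' by (auto simp: x_def is_arg_min_linorder)
    moreover from this have "depot_ok s (narr s Route r x)" "vert (narr s Route r x) = l ! x"
      using vertex by (simp_all add: is_arg_min_def)
    ultimately show ?thesis
      using s' vert_depot by (simp add: x_def cheapest_detour_def depot_ok_def modifies_def)
  qed
  show ?thesis
    by (rule runs_mono[OF nearest _ cheapest]) simp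
qed

abbreviation dispatch_arrays :: "narray set" where
  "dispatch_arrays \<equiv> {Inner, Tour_Walk, Tour_Length, Tour_Units, Tour_Count, Load, Route_Length, Units}"

lemma runs_dispatch:
  assumes input: "input_ok s" and stored: "stores U B ts s"
    and r: "nvar s Target = r" "r < n" "vert r \<in> U" and bag: "is_bag (vert r) (B (vert r))"
    and x: "nvar s Position = x" "x < length (walk (B (vert r)))"
    and z: "narr s Nearest_Depot (narr s Route r x) 0 = z" "z < n + m"
  shows "runs dispatch_com s (14 + 3 * length (walk (B (vert r))) + 6 * n) (\<lambda>s'.
    modifies dispatch_arrays {} s s' \<and>
    stores U (B(vert r := empty_bag (vert r))) (ts @ [depot_tour (vert z) x (B (vert r))]) s')"
    (is "runs _ _ _ ?Q")
proof -
  have "runs dispatch_com s ((10 + 3 * length (walk (B (vert r))) + 3 * n) + (4 + 3 * n)) ?Q"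
    unfolding dispatch_com_def
  proof (rule runs_Seq[OF runs_write_tour[OF input stored r x z]], elim conjE)
    fix t
    assume frame: "modifies {Inner, Tour_Walk, Tour_Length, Tour_Units, Tour_Count} {} s t"
      and stored_t: "stores U B (ts @ [depot_tour (vert z) x (B (vert r))]) t"
    have input_t: "input_ok t"
      by (rule input_ok_modifies[OF frame input]) simp_all
    have target: "nvar t Target = r"
      using frame r(1) by (simp add: modifies_def)
    show "runs empty_bag_com t (4 + 3 * n) ?Q"
      by (rule runs_mono[OF runs_empty_bag[OF input_t stored_t target r(2,3) bag] order_refl])
        (use frame in \<open>simp add: modifies_def\<close>)
  qed
  then show ?thesis
    by (rule runs_mono) simp_all
qed

definition ready :: "state \<Rightarrow> bool" where
  "ready s \<longleftrightarrow> input_ok s \<and> (\<forall>i<n. depot_ok s i)"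

lemma ready_modifies:
  assumes "modifies A {} s s'" "ready s" "A \<inter> {Header, Demand, Nearest_Depot} = {}"
  shows "ready s'"
  using assms input_ok_modifies[OF assms(1)] depot_ok_modifies[OF assms(1)] by (auto simp: ready_def)

lemma runs_emit:
  assumes ready: "ready s" and ps: "partial_solution key U B ts" and stored: "stores U B ts s"
    and r: "nvar s Target = r" "r < n" "vert r \<in> U"
  shows "runs emit_com s (17 + 20 * n) (\<lambda>s'.
    modifies (insert Position dispatch_arrays) {} s s' \<and>
    (\<exists>x u. cheapest_detour (walk (B (vert r))) x u \<and>
      stores U (B(vert r := empty_bag (vert r))) (ts @ [depot_tour u x (B (vert r))]) s'))"
    (is "runs _ _ _ ?Q")
proof -
  let ?l = "walk (B (vert r))"
  have bag: "is_bag (vert r) (B (vert r))"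
    using ps r(3) by (simp add: partial_solution_def)
  then have route: "stores_route s r ?l" "?l \<noteq> []"
    using stored r by (auto simp: stores_def stores_bag_def is_bag_def)
  have depots: "\<forall>i<n. depot_ok s i"
    using ready by (simp add: ready_def)
  have "runs emit_com s ((3 + 4 * length ?l) + (14 + 3 * length ?l + 6 * n)) ?Q"
    unfolding emit_com_def
  proof (rule runs_Seq[OF runs_nearest_position[OF r(1) depots route]], elim conjE exE)
    fix s1 x z
    assume frame: "modifies {Inner, Position} {} s s1" and x: "nvar s1 Position = x"
      and z: "narr s1 Nearest_Depot (narr s1 Route r x) 0 = z" "z < n + m"
      and detour: "cheapest_detour ?l x (vert z)"
    have input1: "input_ok s1"
      using ready_modifies[OF frame ready] by (simp add: ready_def)
    have stored1: "stores U B ts s1" and target1: "nvar s1 Target = r"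
      using stores_modifies[OF frame] stored frame r(1) by (simp_all add: modifies_def)
    have "x < length ?l"
      using detour by (simp add: cheapest_detour_def is_arg_min_def)
    note dispatch = runs_dispatch[OF input1 stored1 target1 r(2,3) bag x this z]
    show "runs dispatch_com s1 (14 + 3 * length ?l + 6 * n) ?Q"
      by (rule runs_mono[OF dispatch order_refl]) (use frame detour in \<open>auto simp: modifies_def\<close>)
  qed
  then show ?thesis
    by (rule runs_mono) (use length_walk_le[OF ps r(3)] in \<open>simp_all add: card_customers\<close>)
qed

section \<open>Serving the customers in reverse Prim order\<close>

definition serving :: "('v \<Rightarrow> real) \<Rightarrow> 'v set \<Rightarrow> state \<Rightarrow> bool" where
  "serving key U s \<longleftrightarrow> (\<exists>B ts. partial_solution key U B ts \<and> loads_ok U B \<and> stores U B ts s)"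

abbreviation serving_arrays :: "narray set" where
  "serving_arrays \<equiv> {Target, Position, Route} \<union> dispatch_arrays"

lemma runs_serve_root:
  assumes ready: "ready s" and serving: "serving key U s"
    and v: "nvar s Processed = v" "v < n" "vert v \<in> U" "key (vert v) = c0 (vert v)"
  shows "runs serve_root_com s (18 + 20 * n) (\<lambda>s'.
    modifies serving_arrays {} s s' \<and> serving key (U - {vert v}) s')"
    (is "runs _ _ _ ?Q")
proof -
  obtain B ts where ps: "partial_solution key U B ts" and loads: "loads_ok U B"
    and stored: "stores U B ts s"
    using serving by (auto simp: serving_def)
  let ?\<beta> = "B (vert v)"
  let ?s = "set_narr Target 0 0 v s"
  have target: "modifies {Target} {} s ?s"
    by simp
  have target_v: "nvar ?s Target = v"
    by simp
  have ready': "ready ?s" and stored': "stores U B ts ?s"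
    using ready_modifies[OF target ready] stores_modifies[OF target] stored by simp_all
  have "runs emit_com ?s (17 + 20 * n) ?Q"
  proof (rule runs_mono[OF runs_emit[OF ready' ps stored' target_v v(2,3)] order_refl], elim conjE exE)
    fix s' x u
    assume frame: "modifies (insert Position dispatch_arrays) {} ?s s'"
      and detour: "cheapest_detour (walk ?\<beta>) x u"
      and stored: "stores U (B(vert v := empty_bag (vert v))) (ts @ [depot_tour u x ?\<beta>]) s'"
    have "stores (U - {vert v}) B (ts @ [depot_tour u x ?\<beta>]) s'"
      using stored v(2) by (auto simp: stores_def)
    then have "serving key (U - {vert v}) s'"
      unfolding serving_def
      using partial_solution_close[OF ps loads v(3,4) detour] loads_ok_mono[OF loads, of "U - {vert v}"]
      by blast
    moreover have "modifies serving_arrays {} s s'"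
      by (rule modifies_trans[OF target frame]) auto
    ultimately show "?Q s'"
      by simp
  qed
  then have "runs serve_root_com s (1 + (17 + 20 * n)) ?Q"
    unfolding serve_root_com_def by (intro runs_NPut_Seq) (simp_all add: v(1))
  then show ?thesis
    by simp
qed

lemma runs_emit_if_heavy:
  assumes ready: "ready s" and ps: "partial_solution key U B ts"
    and loads: "loads_ok (U - {vert r}) B" and stored: "stores U B ts s"
    and r: "nvar s Target = r" "r < n" "vert r \<in> U" "vert r \<in> small_customers I"
    and load: "load (B (vert r)) \<le> k"
  shows "runs emit_if_heavy_com s (18 + 20 * n) (\<lambda>s'.
    modifies serving_arrays {} s s' \<and> serving key U s')"
    (is "runs _ _ _ ?Q")
proof -
  let ?\<beta> = "B (vert r)" and ?heavy = "NLess vehicle_capacity (double (of_target Load))"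
  have loads_update: "loads_ok U (B(vert r := \<gamma>))" if "2 * load \<gamma> \<le> k" for \<gamma>
    using loads r(4) that by (auto simp: loads_ok_def)
  have heavy: "bval ?heavy s \<longleftrightarrow> k < 2 * load ?\<beta>"
    using ready stored r by (auto simp: ready_def input_ok_def stores_def stores_bag_def)
  show ?thesis
    unfolding emit_if_heavy_com_def
  proof (rule runs_Cond)
    assume "bval ?heavy s"
    then have big: "k < 2 * load ?\<beta>"
      using heavy by simp
    have "runs emit_com s (17 + 20 * n) ?Q"
    proof (rule runs_mono[OF runs_emit[OF ready ps stored r(1-3)] order_refl], elim conjE exE)
      fix s' x u
      assume frame: "modifies (insert Position dispatch_arrays) {} s s'"
        and detour: "cheapest_detour (walk ?\<beta>) x u"
        and stored: "stores U (B(vert r := empty_bag (vert r))) (ts @ [depot_tour u x ?\<beta>]) s'"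
      have "serving key U s'"
        unfolding serving_def
        using partial_solution_emit[OF ps r(3) big load detour]
          loads_update[of "empty_bag (vert r)"] stored
        by auto
      then show "?Q s'"
        using frame by (simp add: modifies_def)
    qed
    then show "runs emit_com s (18 + 20 * n - 1) ?Q"
      by simp
  next
    assume "\<not> bval ?heavy s"
    then have "loads_ok U B"
      using heavy loads_update[of ?\<beta>] by simp
    then show "runs Skip s (18 + 20 * n - 1) ?Q"
      using ps stored by (intro runs_Skip) (auto simp: serving_def)
  qed simp
qed

lemma runs_serve_child:
  assumes ready: "ready s" and serving: "serving key U s"
    and v: "nvar s Processed = v" "v < n" "vert v \<in> U" "vert v \<in> small_customers I"
    and r: "narr s Parent v 0 = Suc r" "r < n" "v \<noteq> r" "vert r \<in> U" "vert r \<in> small_customers I"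
    and key: "key (vert v) = w (vert r) (vert v)"
  shows "runs serve_child_com s (26 + 29 * n) (\<lambda>s'.
    modifies serving_arrays {} s s' \<and> serving key (U - {vert v}) s')"
    (is "runs _ _ _ ?Q")
proof -
  obtain B ts where ps: "partial_solution key U B ts" and loads: "loads_ok U B"
    and stored: "stores U B ts s"
    using serving by (auto simp: serving_def)
  let ?\<beta> = "B (vert r)" and ?\<gamma> = "B (vert v)" and ?U = "U - {vert v}"
  let ?B = "B(vert r := merge_bags ?\<beta> ?\<gamma>)"
  have distinct: "vert r \<noteq> vert v"
    using v(2) r(2,3) by simp
  have merged: "partial_solution key ?U ?B ts"
    by (rule partial_solution_merge[OF ps v(3) r(4) distinct v(4) key])
  have "2 * load ?\<beta> \<le> k" "2 * load ?\<gamma> \<le> k"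
    using loads v(3,4) r(4,5) by (auto simp: loads_ok_def)
  then have load: "load (?B (vert r)) \<le> k"
    by simp
  have hd: "hd (walk ?\<beta>) = vert r"
    using ps r(4) by (auto simp: partial_solution_def is_bag_def)
  have input: "input_ok s"
    using ready by (simp add: ready_def)
  have "runs serve_child_com s ((8 + 3 * length (walk ?\<gamma>) + 3 * n) + (18 + 20 * n)) ?Q"
    unfolding serve_child_com_def
  proof (rule runs_Seq[OF runs_merge[OF input stored v(1-3) r(1-4) hd]], elim conjE)
    fix t
    assume frame: "modifies {Inner, Target, Load, Route_Length, Route, Units} {} s t"
      and target: "nvar t Target = r" and stored_t: "stores U ?B ts t"
    have ready_t: "ready t" and stored_U: "stores ?U ?B ts t"
      using ready_modifies[OF frame ready] stores_mono[OF stored_t] by auto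
    have loads_t: "loads_ok (?U - {vert r}) ?B" and rU: "vert r \<in> ?U"
      using loads r(4) distinct by (simp_all add: loads_ok_def)
    show "runs emit_if_heavy_com t (18 + 20 * n) ?Q"
      by (rule runs_mono[OF runs_emit_if_heavy[OF ready_t merged loads_t stored_U
              target r(2) rU r(5) load] order_refl])
        (use frame in \<open>auto simp: modifies_def\<close>)
  qed
  then show ?thesis
    by (rule runs_mono) (use length_walk_le[OF ps v(3)] in \<open>simp_all add: card_customers\<close>)
qed

lemma stored_parent_cases:
  assumes inv: "prim_inv xs par key" and stored: "stores_prim xs par key s"
    and v: "v < n" "p < length xs" "vert v = xs ! p"
  obtains (root) "narr s Parent v 0 = 0" "key (vert v) = c0 (vert v)"
  | (child) r where "narr s Parent v 0 = Suc r" "r < n" "vert r \<in> set (take p xs)"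
      "vert v \<in> small_customers I" "vert r \<in> small_customers I" "key (vert v) = w (vert r) (vert v)"
proof -
  have link: "stores_link s v (par (vert v)) (key (vert v))" "linkable (par (vert v)) (vert v)"
    "key (vert v) = link_weight (par (vert v)) (vert v)" "par (vert v) \<in> reached (take p xs)"
    using stored inv v vert_customer[OF v(1)]
    by (auto simp: stores_prim_def stores_links_def prim_inv_def)
  show thesis
  proof (cases "narr s Parent v 0")
    case 0
    then show thesis
      using root link(1,3) by (simp add: stores_link_def)
  next
    case (Suc r)
    then show thesis
      using child[of r] link by (auto simp: stores_link_def reached_def)
  qed
qed

lemma runs_serve_vertex:
  assumes ready: "ready s" and inv: "prim_inv xs par key" and stored: "stores_prim xs par key s"
    and serving: "serving key (set (take (Suc p) xs)) s"
    and v: "nvar s Processed = v" "v < n" "p < length xs" "vert v = xs ! p"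
  shows "runs (Cond (NLess (NConst 0) (of_processed Parent)) serve_child_com serve_root_com) s
    (27 + 29 * n) (\<lambda>s'. modifies serving_arrays {} s s' \<and> serving key (set (take p xs)) s')"
    (is "runs _ _ _ ?Q")
proof -
  let ?U = "set (take (Suc p) xs)"
  have take: "take (Suc p) xs = take p xs @ [vert v]"
    using v(3,4) by (simp add: take_Suc_conv_app_nth)
  moreover have "distinct (take (Suc p) xs)"
    using inv by (simp add: prim_inv_def)
  ultimately have U: "vert v \<in> ?U" "?U - {vert v} = set (take p xs)"
    by auto
  from inv stored v(2-4) show ?thesis
  proof (cases rule: stored_parent_cases)
    case root
    have "runs serve_root_com s (27 + 29 * n - 1) ?Q"
      by (rule runs_mono[OF runs_serve_root[OF ready serving v(1,2) U(1) root(2)]])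
        (use U(2) in simp_all)
    then show ?thesis
      by (intro runs_Cond) (simp_all add: v(1) root(1))
  next
    case (child r)
    then have r: "vert r \<in> ?U" "v \<noteq> r"
      using U by auto
    have "runs serve_child_com s (27 + 29 * n - 1) ?Q"
      using runs_serve_child[OF ready serving v(1,2) U(1) child(4,1,2) r(2,1) child(5,6)] U(2)
      by simp
    then show ?thesis
      by (intro runs_Cond) (simp_all add: v(1) child(1))
  qed
qed

lemma runs_serve_step:
  assumes ready: "ready s" and inv: "prim_inv xs par key" and i: "i < n" "length xs = n"
    and vars: "nvar s Outer = i" and stored: "stores_prim xs par key s"
    and serving: "serving key (set (take (n - i) xs)) s"
  shows "runs serve_step_com s (28 + 29 * n) (\<lambda>s'.
    modifies (insert Processed serving_arrays) {} s s' \<and> serving key (set (take (n - Suc i) xs)) s')"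
    (is "runs _ _ _ ?Q")
proof -
  define p where "p = n - Suc i"
  define v where "v = narr s Order p 0"
  have p: "p < length xs" "n - i = Suc p"
    using i by (auto simp: p_def)
  have v: "v < n" "vert v = xs ! p"
    using stored p(1) by (simp_all add: stores_prim_def v_def)
  let ?s = "set_narr Processed 0 0 v s"
  have frame: "modifies {Processed} {} s ?s"
    by simp
  have ready': "ready ?s" and serving': "serving key (set (take (Suc p) xs)) ?s"
    using ready_modifies[OF frame ready] serving stores_modifies[OF frame]
    by (simp_all add: serving_def p(2))
  have stored': "stores_prim xs par key ?s" and processed: "nvar ?s Processed = v"
    using stored by (simp_all add: stores_prim_def stores_links_def)
  have "runs (Cond (NLess (NConst 0) (of_processed Parent)) serve_child_com serve_root_com) ?s
    (27 + 29 * n) ?Q"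
    by (rule runs_mono[OF runs_serve_vertex[OF ready' inv stored' serving'
            processed v(1) p(1) v(2)] order_refl])
      (auto simp: modifies_def p_def)
  moreover have "narr s Header 0 0 = n" "narr s Order (n - i - 1) 0 = v"
    using ready by (simp_all add: ready_def input_ok_def v_def p_def)
  ultimately show ?thesis
    unfolding serve_step_com_def by (intro runs_NPut_Seq) (simp_all add: vars)
qed

lemma runs_serve:
  assumes ready: "ready s" and inv: "prim_inv xs par key" and xs: "set xs = V"
    and stored: "stores_prim xs par key s" and serving: "serving key V s"
  shows "runs serve_com s (2 + n * (30 + 29 * n)) (\<lambda>s'. serving key {} s')"
proof -
  let ?frame = "modifies ({Outer, Processed} \<union> serving_arrays) {} s"
  let ?Q = "\<lambda>i s'. ?frame s' \<and> serving key (set (take (n - i) xs)) s'"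
  have length: "length xs = n"
    using inv xs distinct_card[of xs] card_customers by (simp add: prim_inv_def)
  have "runs serve_com s (2 + n * ((28 + 29 * n) + 2)) (?Q n)"
    unfolding serve_com_def
  proof (rule runs_For[where Q = ?Q])
    show "?Q 0 s"
      using serving xs length by simp
    fix i t
    assume i: "i < n" and Q: "?Q i t" and t: "nvar t Outer = i"
    have ready_t: "ready t"
      by (rule ready_modifies[OF conjunct1[OF Q] ready]) simp
    have stored_t: "stores_prim xs par key t"
      using stored Q by (simp add: stores_prim_def stores_links_def stores_link_def modifies_def)
    show "runs serve_step_com t (28 + 29 * n) (\<lambda>s'. nvar s' Outer = i \<and> ?Q (Suc i) s')"
      by (rule runs_mono[OF runs_serve_step[OF ready_t inv i length t stored_t conjunct2[OF Q]]
            order_refl])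
        (use Q t in \<open>auto simp: modifies_def\<close>)
  next
    show "?Q i (set_narr Outer 0 0 j t)" if "?Q i t" for i j t
      using that stores_modifies[of "{Outer}" "{}" t "set_narr Outer 0 0 j t"]
      by (simp add: serving_def)
  qed (use ready in \<open>auto simp: ready_def input_ok_def modifies_def\<close>)
  then show ?thesis
    by (rule runs_mono) (simp_all add: add.commute)
qed

lemma serving_empty_obtains_solution:
  assumes serving: "serving key {} s" and prim: "prim_inv xs par key" "set xs = V"
  obtains sol where "nvar s Tour_Count = length sol" "\<forall>t<length sol. stores_tour s t (sol ! t)"
    and "feasible \<nu> I sol" "\<forall>T. small_min_spanning_tree I T \<longrightarrow>
      solution_cost I sol \<le> detour_rate * Delta I + 2 * edges_weight (aux_weight I) T"
proof -
  obtain B sol where sol: "partial_solution key {} B sol" "stores {} B sol s"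
    using serving by (auto simp: serving_def)
  have "solution_cost I sol \<le> detour_rate * Delta I + 2 * edges_weight (aux_weight I) T"
    if "small_min_spanning_tree I T" for T
    using partial_solution_final(2)[OF sol(1)] sum_key_le_spanning_tree_weight[OF prim that] by simp
  then show thesis
    using that[of sol] sol(2) partial_solution_final(1)[OF sol(1)] by (simp add: stores_def)
qed

theorem runs_vrp:
  assumes input: "input_ok s"
    and blank: "\<And>a. a \<in> {Visited, Parent, Units, Tour_Count} \<Longrightarrow> narr s a = (\<lambda>_ _. 0)"
  shows "runs vrp_com s (6 + n * (51 + 4 * m + 38 * n)) (\<lambda>s'. \<exists>sol.
    nvar s' Tour_Count = length sol \<and> (\<forall>t<length sol. stores_tour s' t (sol ! t)) \<and> feasible \<nu> I sol \<and>
    (\<forall>T. small_min_spanning_tree I T \<longrightarrow>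
      solution_cost I sol \<le> detour_rate * Delta I + 2 * edges_weight (aux_weight I) T))"
    (is "runs _ _ _ ?Q")
proof -
  have units: "narr s Units = (\<lambda>_ _. 0)"
    using blank by simp
  have "runs vrp_com s ((2 + n * (12 + m * 4)) + ((2 + n * (9 + n * 9)) + (2 + n * (30 + 29 * n)))) ?Q"
    unfolding vrp_com_def
  proof (rule runs_Seq[OF runs_init[OF input units]])
    fix s1
    assume s1: "modifies (insert Outer init_arrays) {Depot_Dist, Key} s s1 \<and> (\<forall>i<n. init_ok s1 i)"
    have input1: "input_ok s1"
      by (rule input_ok_modifies[OF conjunct1[OF s1] input]) simp_all
    have blank1: "narr s1 Visited = (\<lambda>_ _. 0)" "narr s1 Parent = (\<lambda>_ _. 0)"
      and key1: "\<forall>i<n. rarr s1 Key i 0 = c0 (vert i)" and stored1: "stores V (demand_bag d) [] s1"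
      using s1 blank by (simp_all add: modifies_def init_ok_def stores_def)
    show "runs (prim_com ;; serve_com) s1 ((2 + n * (9 + n * 9)) + (2 + n * (30 + 29 * n))) ?Q"
    proof (rule runs_Seq[OF runs_prim[OF input1 blank1 key1]], elim conjE)
      fix s2
      assume s2: "modifies {Outer, Inner, Selected, Visited, Order, Parent} {Key} s1 s2"
      assume "prim_stage n s2"
      then obtain xs par key where prim: "prim_inv xs par key" "set xs = V" "stores_prim xs par key s2"
        by (rule prim_stage_final)
      have ready2: "ready s2"
        using input_ok_modifies[OF s2 input1] depot_ok_modifies[OF s2] s1
        by (simp add: ready_def init_ok_def)
      have "stores V (demand_bag d) [] s2"
        using stores_modifies[OF s2] stored1 by simp
      then have "serving key V s2"
        using partial_solution_initial loads_ok_initial unfolding serving_def by blast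
      then show "runs serve_com s2 (2 + n * (30 + 29 * n)) ?Q"
        using serving_empty_obtains_solution[OF _ prim(1,2)]
        by (intro runs_mono[OF runs_serve[OF ready2 prim] order_refl]) metis+
    qed
  qed
  then show ?thesis
    by (rule runs_mono) (simp_all add: algebra_simps)
qed

end

section \<open>Presented instances\<close>

locale presented_instance = vrp_instance I for I :: "'v mcvrp" +
  fixes vs ds :: "'v list"
  assumes presentation: "presentation I vs ds"
begin

lemma bij_betw_vertices:
  "bij_betw ((!) (vs @ ds)) {..<length vs} (customers I)"
  "bij_betw ((!) (vs @ ds)) {length vs..<length vs + length ds} (depots I)"
proof -
  have "bij_betw ((!) (vs @ ds)) {..<length vs} (set vs) \<longleftrightarrow> bij_betw ((!) vs) {..<length vs} (set vs)"
    by (rule bij_betw_cong) (simp add: nth_append)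
  then show "bij_betw ((!) (vs @ ds)) {..<length vs} (customers I)"
    using presentation bij_betw_nth[of vs "{..<length vs}" "set vs"] by (simp add: presentation_def)
  have shift: "bij_betw ((+) (length vs)) {..<length ds} {length vs..<length vs + length ds}"
    by (simp add: bij_betw_def lessThan_atLeast0 add.commute)
  have "bij_betw ((!) (vs @ ds) \<circ> (+) (length vs)) {..<length ds} (depots I)"
    using presentation bij_betw_nth[of ds "{..<length ds}" "set ds"]
    by (simp add: presentation_def comp_def nth_append)
  then show "bij_betw ((!) (vs @ ds)) {length vs..<length vs + length ds} (depots I)"
    by (simp add: bij_betw_comp_iff[OF shift])
qed

sublocale vrp_memory I "(!) (vs @ ds)" "length vs" "length ds"
  by unfold_locales (rule bij_betw_vertices)+

lemma input_ok_input_state: "input_ok (input_state I vs ds)"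
  by (simp add: input_ok_def narr_def rarr_def input_state_def narray_code.simps rarray_code.simps
      nth_append del: cell_eq_array)

lemma blank_input_state:
  "a \<in> {Visited, Parent, Units, Tour_Count} \<Longrightarrow> narr (input_state I vs ds) a = (\<lambda>_ _. 0)"
  by (auto simp: narr_def input_state_def narray_code.simps fun_eq_iff simp del: cell_eq_array)

lemma outputs_if_stores_tours:
  assumes "nvar s Tour_Count = length sol" "\<forall>t<length sol. stores_tour s t (sol ! t)"
  shows "outputs s vs ds sol"
  using assms
  by (simp add: outputs_def stores_tour_def stores_tour_walk_def narr_def narray_code.simps nth_append
      del: cell_eq_array)

lemma num_vertices_le_instance_size: "length vs + length ds \<le> instance_size I"
proof -
  have "card (vertices I) = length vs + length ds"
    using presentation finite_customers finite_depots customers_not_depots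
    by (simp add: presentation_def card_Un_disjoint flip: distinct_card)
  moreover have "card (vertices I) \<le> (card (vertices I))\<^sup>2"
    by (simp add: power2_eq_square)
  ultimately show ?thesis
    by (simp add: instance_size_def)
qed

lemma running_time_le:
  "6 + length vs * (51 + 4 * length ds + 38 * length vs) \<le> poly [:6, 51, 42:] (instance_size I)"
proof -
  have "length vs * (51 + 4 * length ds + 38 * length vs) \<le>
      instance_size I * (51 + 42 * instance_size I)"
    using num_vertices_le_instance_size by (intro mult_le_mono) auto
  then show ?thesis
    by (simp add: algebra_simps)
qed

end

theorem theorem1:
  fixes \<nu> :: problem_variant
  shows "\<exists>(P :: com) (p :: nat poly).
    \<forall>(I :: 'v mcvrp) vs ds.
      variant_instance \<nu> I \<and> (\<forall>v\<in>customers I. demand I v \<le> capacity I) \<and>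
      presentation I vs ds \<longrightarrow>
      (\<exists>t s sol.
         exec P (input_state I vs ds) t s \<and>
         t \<le> poly p (instance_size I) \<and>
         outputs s vs ds sol \<and>
         feasible \<nu> I sol \<and>
         (\<forall>T. small_min_spanning_tree I T \<longrightarrow>
            solution_cost I sol
              \<le> 2 / (real (capacity I div 2) + 1) * Delta I
                + 2 * edges_weight (aux_weight I) T))"
proof (intro exI[of _ vrp_com] exI[of _ "[:6, 51, 42:]"] allI impI, elim conjE)
  fix I :: "'v mcvrp" and vs ds
  assume "variant_instance \<nu> I" "\<forall>v\<in>customers I. demand I v \<le> capacity I" "presentation I vs ds"
  then interpret presented_instance I vs ds
    by unfold_locales (auto simp: variant_instance_def)
  obtain t s sol where run: "exec vrp_com (input_state I vs ds) t s"
      "t \<le> 6 + length vs * (51 + 4 * length ds + 38 * length vs)"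
    and tours: "nvar s Tour_Count = length sol" "\<forall>t<length sol. stores_tour s t (sol ! t)"
    and sol: "feasible \<nu> I sol" "\<forall>T. small_min_spanning_tree I T \<longrightarrow>
      solution_cost I sol \<le> detour_rate * Delta I + 2 * edges_weight (aux_weight I) T"
    using runs_vrp[OF input_ok_input_state blank_input_state] unfolding runs_def by blast
  show "\<exists>t s sol. exec vrp_com (input_state I vs ds) t s \<and>
      t \<le> poly [:6, 51, 42:] (instance_size I) \<and>
      outputs s vs ds sol \<and> feasible \<nu> I sol \<and>
      (\<forall>T. small_min_spanning_tree I T \<longrightarrow> solution_cost I sol
        \<le> 2 / (real (capacity I div 2) + 1) * Delta I + 2 * edges_weight (aux_weight I) T)"
    using run(1) le_trans[OF run(2) running_time_le] outputs_if_stores_tours[OF tours]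
      sol[unfolded detour_rate_def] by blast
qed

end
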